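(* Let $(H,\ell_H)\in\mathcal{G}_{or(n)}$ and suppose the permutation $\mu\in S_n$ corresponds to an element of the automorphism group of $H$ (as an embedded graph), that is, $(\mathbf{1},\mu)(H,\ell_H)=(H,\ell_H)$. Then for every $\hat\alpha\in\mathfrak{S}^n$, the graph $(G,\ell_G)=(\hat\alpha,\iota)(H,\ell_H)$ is self-$\hat\gamma'$ via $\mu$ with $\hat\gamma'=\hat\alpha\cdot\hat\alpha^{-1}\mu^{-1}$, and $\hat\gamma'$ is non-trivial exactly when $\hat\alpha\neq\hat\alpha\mu^{-1}$.
   Context: **Ribbon graphs.** A (finite) ribbon graph $G=(V(G),E(G))$ is a surface with boundary presented as the union of a set $V(G)$ of discs (vertices) and a set $E(G)$ of discs (edges) such that vertices and edges intersect in disjoint line segments, each such segment lies on the boundary of precisely one vertex and precisely one edge, and every edge contains exactly two such segments. Two ribbon graphs are isomorphic if there is a homeomorphism (not required to preserve any orientation) taking vertices to vertices and edges to edges; equivalently, if the corresponding cellularly embedded graphs are isomorphic. **Arrow presentations.** A ribbon graph is encoded by drawing each vertex boundary as a circle and recording, for each edge $e$, two directed arcs (arrows) labelled $e$ on the circles, namely the two segments where $e$ meets vertices, directed by an arbitrary orientation of the boundary of the disc $e$. **Operations on one edge.** Let $A,B$ be the two arrows labelled $e$. The partial Petrial (twist) $\tau$ at $e$ reverses the direction of exactly one of $A,B$. The partial dual $\delta$ at $e$: draw a segment with an arrow on it labelled $e$ directed from the head of $A$ to the tail of $B$, and another with an arrow labelled $e$ directed from the head of $B$ to the tail of $A$;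 then delete $A$, $B$ and the arcs containing them. Vertices may change; the set of edges (labels) is unchanged. It is known that the group $\mathfrak{S} = \langle \delta,\tau \mid \delta^2,\tau^2,(\tau\delta)^3\rangle \cong S_3$ thereby acts on the left on any fixed edge (in a product the rightmost factor is applied first), and operations on distinct edges commute. **Ordered graphs.** $[n]=\{1,\dots,n\}$. $\mathcal{G}_{or(n)}$ is the set of isomorphism classes of pairs $(G,\ell)$, where $G$ is a ribbon graph with exactly $n$ edges ($n\ge 1$) and $\ell\colon[n]\to E(G)$ is a bijection (a linear ordering of the edges). $(G,\ell_G)$ and $(H,\ell_H)$ are isomorphic if there is a ribbon graph isomorphism $G\to H$ whose edge bijection $g$ satisfies $g\circ\ell_G=\ell_H$. **Group action.** An element $\hat\gamma\in\mathfrak{S}^n$ is regarded as a map $[n]\to\mathfrak{S}$; multiplication (written $\cdot$) and inversion in $\mathfrak{S}^n$ are entrywise, and $\hat\gamma\pi$, for $\pi\in S_n$, is composition of maps (binding tighter than $\cdot$; $\hat\alpha^{-1}\mu^{-1}$ is the entrywise inverse of $\hat\alpha$ composed with the permutation $\mu^{-1}$). The identity of $\mathfrak{S}^n$ is $\mathbf{1}$ and that of $S_n$ is $\iota$. $G^{\Gamma(\hat\gamma,\ell)}$ denotes the ribbon graph obtained from $G$ by applying to each edge $e$ the operation $\hat\gamma(\ell^{-1}(e))$. The group $\mathfrak{S}^n\rtimes S_n$, with multiplication $(\hat\gamma_1,\pi_1)(\hat\gamma_2,\pi_2)=(\hat\gamma_1\cdot\hat\gamma_2\pi_1^{-1},\pi_1\pi_2)$,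 acts on $\mathcal{G}_{or(n)}$ by $(\hat\gamma,\pi)(G,\ell)=(G^{\Gamma(\hat\gamma,\ell\pi^{-1})},\ell\pi^{-1})$. **Self-$\hat\gamma$.** $(G,\ell)$ is self-$\hat\gamma$ via $\mu\in S_n$ if $(\hat\gamma,\mu)(G,\ell)=(G,\ell)$ in $\mathcal{G}_{or(n)}$ (here $\hat\gamma$ may be the identity). *)

theory Defs
  imports "HOL-Analysis.Analysis" "HOL-Algebra.Sym_Groups" "HOL-Algebra.Product_Groups"
begin

section \<open>Ribbon graphs\<close>

definition surface_with_boundary :: "'a topology \<Rightarrow> bool" where
  "surface_with_boundary X \<longleftrightarrow>
     Hausdorff_space X \<and> second_countable X \<and>
     (\<forall>x \<in> topspace X. \<exists>U W. openin X U \<and> x \<in> U \<and>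
        openin (top_of_set {z::complex. 0 \<le> Im z}) W \<and>
        subtopology X U homeomorphic_space top_of_set W)"

definition disc_param :: "'a topology \<Rightarrow> 'a set \<Rightarrow> (complex \<Rightarrow> 'a) \<Rightarrow> bool" where
  "disc_param X D h \<longleftrightarrow>
     D \<subseteq> topspace X \<and> homeomorphic_map (top_of_set (cball 0 1)) (subtopology X D) h"

definition is_disc :: "'a topology \<Rightarrow> 'a set \<Rightarrow> bool" where
  "is_disc X D \<longleftrightarrow> (\<exists>h. disc_param X D h)"

text \<open>By invariance of domain every parametrisation of a disc yields the same boundary circle.\<close>

definition disc_boundary :: "'a topology \<Rightarrow> 'a set \<Rightarrow> 'a set" where
  "disc_boundary X D = (\<Union>h \<in> {h. disc_param X D h}. h ` sphere 0 1)"

definition is_line_segment :: "'a topology \<Rightarrow> 'a set \<Rightarrow> bool" where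
  "is_line_segment X s \<longleftrightarrow>
     s \<subseteq> topspace X \<and> subtopology X s homeomorphic_space top_of_set {0..1::real}"

record 'a ribbon =
  surf :: "'a topology"
  verts :: "'a set set"
  edges :: "'a set set"

text \<open>
  The disjoint segments in which vertices meet edges are exactly the connected components of the
  intersection of the union of the vertices with the union of the edges.
\<close>

definition segments :: "'a ribbon \<Rightarrow> 'a set set" where
  "segments G = connected_components_of (subtopology (surf G) (\<Union>(verts G) \<inter> \<Union>(edges G)))"

definition segments_of_edge :: "'a ribbon \<Rightarrow> 'a set \<Rightarrow> 'a set set" where
  "segments_of_edge G e = {s \<in> segments G. s \<subseteq> e}"

definition ribbon_graph :: "'a ribbon \<Rightarrow> bool" where
  "ribbon_graph G \<longleftrightarrow>
     surface_with_boundary (surf G) \<and>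
     finite (verts G) \<and> finite (edges G) \<and>
     topspace (surf G) = \<Union>(verts G) \<union> \<Union>(edges G) \<and>
     (\<forall>D \<in> verts G \<union> edges G. is_disc (surf G) D) \<and>
     disjoint (verts G) \<and> disjoint (edges G) \<and>
     (\<forall>s \<in> segments G. is_line_segment (surf G) s \<and>
        (\<exists>!v. v \<in> verts G \<and> s \<subseteq> disc_boundary (surf G) v) \<and>
        (\<exists>!e. e \<in> edges G \<and> s \<subseteq> disc_boundary (surf G) e)) \<and>
     (\<forall>e \<in> edges G. card (segments_of_edge G e) = 2)"

definition ribbon_iso :: "'a ribbon \<Rightarrow> 'b ribbon \<Rightarrow> ('a \<Rightarrow> 'b) \<Rightarrow> bool" where
  "ribbon_iso G H f \<longleftrightarrow>
     homeomorphic_map (surf G) (surf H) f \<and>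
     (\<lambda>D. f ` D) ` verts G = verts H \<and> (\<lambda>D. f ` D) ` edges G = edges H"


section \<open>Arrow presentations\<close>

text \<open>
  Up to homeomorphism, a family of circles carrying disjoint directed labelled arcs (two for each
  label) is determined by which endpoints of the arrows are joined by an arrow-free arc of a circle,
  and by the number of circles that carry no arrow at all. An element of \<open>gaps\<close> is the pair of
  endpoints of such an arrow-free arc; the circles themselves are recovered by following arrows
  and gaps alternately.
\<close>

datatype which_arrow = ArrowA | ArrowB
datatype tip = Tail | Head

type_synonym 'l endpoint = "'l \<times> which_arrow \<times> tip"

record 'l arrow_presentation =
  labels :: "'l set"
  gaps :: "'l endpoint set set"
  bare_circles :: nat

definition endpoints :: "'l arrow_presentation \<Rightarrow> 'l endpoint set" where
  "endpoints P = labels P \<times> UNIV"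

text \<open>
  The arcs that remain of the vertex boundaries when the segments are removed; for a vertex that
  meets no edge this is the whole boundary circle.
\<close>

definition free_arcs :: "'a ribbon \<Rightarrow> 'a set set" where
  "free_arcs G = connected_components_of
     (subtopology (surf G) ((\<Union>v \<in> verts G. disc_boundary (surf G) v) - \<Union>(segments G)))"

text \<open>
  The boundary circle of the edge disc \<open>e\<close>, oriented by some parametrisation \<open>h\<close> of the disc
  (both orientations arise, by reflecting \<open>h\<close>), directs the two segments of \<open>e\<close>; \<open>c\<close> gives the
  resulting tail and head of each of the two arrows.
\<close>

definition edge_arrows :: "'a ribbon \<Rightarrow> 'a set \<Rightarrow> (which_arrow \<times> tip \<Rightarrow> 'a) \<Rightarrow> bool" where
  "edge_arrows G e c \<longleftrightarrow>
     (\<exists>h t1 t2 t3 t4. disc_param (surf G) e h \<and>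
        t1 < t2 \<and> t2 < t3 \<and> t3 < t4 \<and> t4 < t1 + 2 * pi \<and>
        segments_of_edge G e = {(\<lambda>t. h (cis t)) ` {t1..t2}, (\<lambda>t. h (cis t)) ` {t3..t4}} \<and>
        c (ArrowA, Tail) = h (cis t1) \<and> c (ArrowA, Head) = h (cis t2) \<and>
        c (ArrowB, Tail) = h (cis t3) \<and> c (ArrowB, Head) = h (cis t4))"

text \<open>\<open>P\<close> is an arrow presentation of \<open>G\<close>, where the label \<open>l\<close> stands for the edge \<open>lab l\<close> of \<open>G\<close>.\<close>

definition presents :: "'l arrow_presentation \<Rightarrow> 'a ribbon \<Rightarrow> ('l \<Rightarrow> 'a set) \<Rightarrow> bool" where
  "presents P G lab \<longleftrightarrow>
     bij_betw lab (labels P) (edges G) \<and>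
     (\<exists>c. (\<forall>l \<in> labels P. edge_arrows G (lab l) (\<lambda>x. c (l, x))) \<and>
          gaps P = {{p \<in> endpoints P. c p \<in> surf G closure_of K} | K. K \<in> free_arcs G} - {{}}) \<and>
     bare_circles P = card {v \<in> verts G. v \<inter> \<Union>(edges G) = {}}"


section \<open>The group generated by partial duals and partial Petrials\<close>

datatype gen = \<delta> | \<tau>

text \<open>
  Equality of words in the group presented by \<open>\<delta>\<^sup>2\<close>, \<open>\<tau>\<^sup>2\<close>, \<open>(\<tau>\<delta>)\<^sup>3\<close>. The first two relators make
  both generators self-inverse, so words without formal inverses suffice.
\<close>

inductive word_eq :: "gen list \<Rightarrow> gen list \<Rightarrow> bool" where
  refl: "word_eq u u"
| sym: "word_eq u v \<Longrightarrow> word_eq v u"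
| trans: "word_eq u v \<Longrightarrow> word_eq v w \<Longrightarrow> word_eq u w"
| append: "word_eq u u' \<Longrightarrow> word_eq v v' \<Longrightarrow> word_eq (u @ v) (u' @ v')"
| delta_sq: "word_eq [\<delta>, \<delta>] []"
| tau_sq: "word_eq [\<tau>, \<tau>] []"
| tau_delta_cube: "word_eq [\<tau>, \<delta>, \<tau>, \<delta>, \<tau>, \<delta>] []"

quotient_type frakS = "gen list" / word_eq
  morphisms rep_word of_word
  by (rule equivpI)
     (auto intro!: reflpI sympI transpI intro: word_eq.refl word_eq.sym word_eq.trans)

lift_definition frakS_mult :: "frakS \<Rightarrow> frakS \<Rightarrow> frakS" is "(@)"
  by (rule word_eq.append)

lift_definition frakS_one :: frakS is "[]" .

definition frakS_group :: "frakS monoid" where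
  "frakS_group = \<lparr>carrier = UNIV, mult = frakS_mult, one = frakS_one\<rparr>"

lemma word_eq_rev_append: "word_eq (rev u @ u) []"
proof (induction u)
  case Nil
  show ?case by (simp add: word_eq.refl)
next
  case (Cons g u)
  have "word_eq [g, g] []"
    by (cases g) (auto intro: word_eq.delta_sq word_eq.tau_sq)
  then have "word_eq (rev u @ [g, g] @ u) (rev u @ [] @ u)"
    by (intro word_eq.append word_eq.refl)
  then show ?case
    using Cons.IH by (auto intro: word_eq.trans)
qed

lemma group_frakS_group: "group frakS_group"
proof (rule groupI)
  fix x assume "x \<in> carrier frakS_group"
  have "\<exists>y. frakS_mult y x = frakS_one"
    by transfer (blast intro: word_eq_rev_append)
  then show "\<exists>y \<in> carrier frakS_group. y \<otimes>\<^bsub>frakS_group\<^esub> x = \<one>\<^bsub>frakS_group\<^esub>"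
    by (simp add: frakS_group_def)
next
  fix x y z
  have "frakS_mult (frakS_mult x y) z = frakS_mult x (frakS_mult y z)"
    by transfer (simp add: word_eq.refl)
  then show "x \<otimes>\<^bsub>frakS_group\<^esub> y \<otimes>\<^bsub>frakS_group\<^esub> z = x \<otimes>\<^bsub>frakS_group\<^esub> (y \<otimes>\<^bsub>frakS_group\<^esub> z)"
    by (simp add: frakS_group_def)
next
  fix x
  have "frakS_mult frakS_one x = x"
    by transfer (simp add: word_eq.refl)
  then show "\<one>\<^bsub>frakS_group\<^esub> \<otimes>\<^bsub>frakS_group\<^esub> x = x"
    by (simp add: frakS_group_def)
qed (simp_all add: frakS_group_def)

abbreviation frakS_pow :: "nat \<Rightarrow> (nat \<Rightarrow> frakS) monoid" where
  "frakS_pow n \<equiv> product_group {1..n} (\<lambda>_. frakS_group)"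


section \<open>Operations on edges\<close>

text \<open>
  An operation at an edge keeps the gaps and all arrow endpoints in place and only redraws the two
  arrows of that edge. \<open>redraw g p\<close> is the role played after the operation \<open>g\<close> by the point
  that was \<open>p\<close> before it. For \<open>\<delta>\<close> the new arrow \<open>A\<close> runs from the old head of \<open>A\<close> to the old
  tail of \<open>B\<close>, and the new arrow \<open>B\<close> from the old head of \<open>B\<close> to the old tail of \<open>A\<close>; for \<open>\<tau>\<close> the
  arrow \<open>A\<close> is reversed.
\<close>

fun redraw :: "gen \<Rightarrow> which_arrow \<times> tip \<Rightarrow> which_arrow \<times> tip" where
  "redraw \<delta> (ArrowA, Head) = (ArrowA, Tail)"
| "redraw \<delta> (ArrowB, Tail) = (ArrowA, Head)"
| "redraw \<delta> (ArrowB, Head) = (ArrowB, Tail)"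
| "redraw \<delta> (ArrowA, Tail) = (ArrowB, Head)"
| "redraw \<tau> (ArrowA, Tail) = (ArrowA, Head)"
| "redraw \<tau> (ArrowA, Head) = (ArrowA, Tail)"
| "redraw \<tau> (ArrowB, t) = (ArrowB, t)"

text \<open>In a word the rightmost operation is applied first.\<close>

definition redraw_word :: "gen list \<Rightarrow> which_arrow \<times> tip \<Rightarrow> which_arrow \<times> tip" where
  "redraw_word w = foldr redraw w"

text \<open>The word \<open>w l\<close> is applied at each label \<open>l\<close>.\<close>

definition apply_words ::
    "('l \<Rightarrow> gen list) \<Rightarrow> 'l arrow_presentation \<Rightarrow> 'l arrow_presentation" where
  "apply_words w P = P\<lparr>gaps := (\<lambda>a. (\<lambda>(l, x). (l, redraw_word (w l) x)) ` a) ` gaps P\<rparr>"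

text \<open>
  \<open>G'\<close> results from \<open>G\<close> by applying the group element \<open>\<Gamma> e\<close> to each edge \<open>e\<close>, and \<open>lab e\<close> is the edge
  of \<open>G'\<close> that corresponds to (carries the label of) the edge \<open>e\<close> of \<open>G\<close>. This determines \<open>G'\<close> up to
  isomorphism.
\<close>

definition twisted_dual ::
    "'a ribbon \<Rightarrow> ('a set \<Rightarrow> frakS) \<Rightarrow> 'a ribbon \<Rightarrow> ('a set \<Rightarrow> 'a set) \<Rightarrow> bool" where
  "twisted_dual G \<Gamma> G' lab \<longleftrightarrow>
     (\<exists>P w. presents P G (\<lambda>e. e) \<and> (\<forall>e \<in> edges G. of_word (w e) = \<Gamma> e) \<and>
            presents (apply_words w P) G' lab)"


section \<open>Ordered ribbon graphs and the group action\<close>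

type_synonym 'a ordered_ribbon = "'a ribbon \<times> (nat \<Rightarrow> 'a set)"

definition ordered_ribbon_graphs :: "nat \<Rightarrow> 'a ordered_ribbon set" where
  "ordered_ribbon_graphs n = {(G, ell). ribbon_graph G \<and> bij_betw ell {1..n} (edges G)}"

definition ordered_iso :: "nat \<Rightarrow> ('a ordered_ribbon \<times> 'a ordered_ribbon) set" where
  "ordered_iso n =
     {((G, ellG), (H, ellH)). (G, ellG) \<in> ordered_ribbon_graphs n \<and> (H, ellH) \<in> ordered_ribbon_graphs n \<and>
        (\<exists>f. ribbon_iso G H f \<and> (\<forall>i \<in> {1..n}. f ` ellG i = ellH i))}"

definition G_or :: "nat \<Rightarrow> 'a ordered_ribbon set set" where
  "G_or n = ordered_ribbon_graphs n // ordered_iso n"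

definition Gamma :: "nat \<Rightarrow> (nat \<Rightarrow> frakS) \<Rightarrow> (nat \<Rightarrow> 'a set) \<Rightarrow> 'a set \<Rightarrow> frakS" where
  "Gamma n \<gamma> ell e = \<gamma> (the_inv_into {1..n} ell e)"

text \<open>
  The action of \<open>(\<gamma>, \<pi>)\<close> on an isomorphism class \<open>C\<close>, itself given as a class: all ordered ribbon
  graphs \<open>(G', ell')\<close> that represent the result for some representative \<open>(G, ell)\<close> of \<open>C\<close>.
\<close>

definition act ::
    "nat \<Rightarrow> (nat \<Rightarrow> frakS) \<times> (nat \<Rightarrow> nat) \<Rightarrow> 'a ordered_ribbon set \<Rightarrow> 'a ordered_ribbon set" where
  "act n = (\<lambda>(\<gamma>, \<pi>) C.
     {(G', ell') \<in> ordered_ribbon_graphs n. \<exists>(G, ell) \<in> C. \<exists>lab.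
        twisted_dual G (Gamma n \<gamma> (ell \<circ> inv' \<pi>)) G' lab \<and>
        (\<forall>i \<in> {1..n}. ell' i = lab ((ell \<circ> inv' \<pi>) i))})"

definition self_via ::
    "nat \<Rightarrow> (nat \<Rightarrow> frakS) \<Rightarrow> (nat \<Rightarrow> nat) \<Rightarrow> 'a ordered_ribbon set \<Rightarrow> bool" where
  "self_via n \<gamma> \<mu> C \<longleftrightarrow> act n (\<gamma>, \<mu>) C = C"

end

theory Submission
  imports Defs
begin

text \<open>
  In the group \<open>\<SS>\<^sup>n \<rtimes> S\<^sub>n\<close> one has \<open>(\<gamma>', \<mu>)(\<alpha>, \<iota>) = (\<alpha>, \<mu>) = (\<alpha>, \<iota>)(1, \<mu>)\<close>. Applied to \<open>H\<close>,
  which \<open>(1, \<mu>)\<close> fixes, this gives \<open>(\<gamma>', \<mu>) G = (\<alpha>, \<iota>) H = G\<close>. The work lies in justifying the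
  computation for ribbon graphs that are topological spaces.

  Two twisted duals are composed by concatenating words, but the intermediate graph carries two
  arrow presentations, one produced by the first operation and one chosen for the second. They may
  differ, at each edge, in which arrow is called \<open>A\<close> and in the orientation of the edge disc. These
  choices permute the four arrow ends of an edge by a Klein four-group. That no other permutation
  can occur is topology: a homeomorphism of the disc preserves the boundary circle (invariance of
  domain), hence the two segments of the edge and the two arcs between them, and an arrow end is
  the corner where a segment meets one of these arcs (\<open>edge_arrows_unique\<close>). The four-group is
  harmless because it is the kernel of the map from the symmetric group on the arrow ends onto
  \<open>\<SS>\<close>: each of its elements is performed by a word that is trivial in \<open>\<SS>\<close>
  (\<open>klein_four_words\<close>). So \<open>twisted_dual_compose\<close> and \<open>twisted_dual_inverse\<close> hold.

  The action on classes is defined through the graphs that result, so splitting a product of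
  group elements requires an intermediate graph. None has to be constructed. Let \<open>G'\<close> be an
  \<open>\<alpha>\<close>-twisted dual of \<open>K\<close>, with \<open>(K, \<ell>)\<close> in \<open>H\<close>. Then \<open>K\<close> has an arrow presentation, so
  \<open>(K, \<ell>\<mu>\<^sup>-\<^sup>1)\<close> lies in \<open>(1, \<mu>) H = H\<close> (\<open>automorphism_acts\<close>) and some homeomorphism of \<open>K\<close> takes
  \<open>\<ell>\<mu>\<^sup>-\<^sup>1\<close> to \<open>\<ell>\<close>. If \<open>G\<^sub>2\<close> comes from \<open>G'\<close> by
  \<open>(\<gamma>', \<mu>)\<close>, it is therefore an \<open>\<alpha>\<close>-twisted dual of \<open>(K, \<ell>\<mu>\<^sup>-\<^sup>1)\<close>, so it lies in \<open>G\<close>; this is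
  one inclusion. For the other, going from \<open>G'\<close> back to \<open>K\<close> by \<open>\<alpha>\<^sup>-\<^sup>1\<close>, through the
  homeomorphism of \<open>K\<close>, and on to \<open>G'\<close> by \<open>\<alpha>\<close> shows that \<open>G'\<close> itself is a preimage of \<open>G'\<close>
  under \<open>(\<gamma>', \<mu>)\<close>.
\<close>

section \<open>Arcs on the circle and homeomorphisms of the disc\<close>

lemma cis_eq_imp_eq:
  assumes "cis s = cis t" "\<bar>s - t\<bar> < 2 * pi"
  shows "s = t"
proof -
  have "\<i> * complex_of_real s = \<i> * complex_of_real t"
  proof (rule exp_complex_eqI)
    show "exp (\<i> * complex_of_real s) = exp (\<i> * complex_of_real t)"
      using assms(1) by (simp only: cis_conv_exp)
  qed (use assms(2) in simp)
  then show ?thesis by simp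
qed

lemma inj_on_cis_period: "inj_on cis {a..<a + 2 * pi}"
  by (intro inj_onI cis_eq_imp_eq) auto

lemma cis_period: "cis (t + 2 * pi) = cis t"
  by (simp add: cis.code)

lemma cis_image_period: "cis ` {a..<a + 2 * pi} = sphere 0 1"
proof (intro equalityI subsetI)
  fix z :: complex assume "z \<in> sphere 0 1"
  then obtain r where z: "z = cis r"
    by (metis complex_unimodular_polar cis.code dist_0_norm mem_sphere complex.collapse cis.sel)
  define m where "m = \<lfloor>(r - a) / (2 * pi)\<rfloor>"
  have "of_int m \<le> (r - a) / (2 * pi)" "(r - a) / (2 * pi) < of_int m + 1"
    unfolding m_def by linarith+
  then have "of_int m * (2 * pi) \<le> r - a" "r - a < (of_int m + 1) * (2 * pi)"
    by (simp_all add: field_simps)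
  then have "r - 2 * pi * of_int m \<in> {a..<a + 2 * pi}"
    by (simp add: algebra_simps)
  moreover have "cis (r - 2 * pi * of_int m) = z"
    using cis_multiple_2pi[of "of_int m"] by (simp add: z flip: cis_divide)
  ultimately show "z \<in> cis ` {a..<a + 2 * pi}" by blast
qed auto

lemma closure_open_arc:
  assumes "a < b"
  shows "closure (cis ` {a<..<b}) = cis ` {a..b}"
proof
  have "closed (cis ` {a..b})"
    by (intro compact_imp_closed compact_continuous_image continuous_intros compact_Icc)
  then show "closure (cis ` {a<..<b}) \<subseteq> cis ` {a..b}"
    by (intro closure_minimal image_mono) auto
  have "cis ` closure {a<..<b} \<subseteq> closure (cis ` {a<..<b})"
    by (intro image_closure_subset continuous_intros closure_subset) auto
  then show "cis ` {a..b} \<subseteq> closure (cis ` {a<..<b})"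
    using assms by simp
qed

text \<open>
  Four points in cyclic order cut the circle into the segments \<open>S1\<close>, \<open>S2\<close> of an edge and the arcs
  \<open>F1\<close>, \<open>F2\<close> between them. The facts below describe the \<open>F\<close> arcs and the four points topologically
  in terms of the segments, so that any homeomorphism of the circle that respects the segments
  respects them too.
\<close>

lemma circle_four_arcs:
  fixes t1 t2 t3 t4 :: real
  assumes "t1 < t2" "t2 < t3" "t3 < t4" "t4 < t1 + 2 * pi"
  defines "S1 \<equiv> cis ` {t1..t2}" and "S2 \<equiv> cis ` {t3..t4}"
    and "F1 \<equiv> cis ` {t2..t3}" and "F2 \<equiv> cis ` {t4..t1 + 2 * pi}"
  shows "closure (sphere 0 1 - (S1 \<union> S2)) = F1 \<union> F2"
    and "F1 \<inter> F2 = {}"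
    and "S1 \<inter> F2 = {cis t1}" "S1 \<inter> F1 = {cis t2}" "S2 \<inter> F1 = {cis t3}" "S2 \<inter> F2 = {cis t4}"
    and "S1 \<subseteq> sphere 0 1" "S2 \<subseteq> sphere 0 1"
proof -
  let ?I = "{t1..<t1 + 2 * pi}"
  note inj = inj_on_cis_period[of t1]
  \<comment> \<open>Moving the endpoint back by one period puts all four arcs into a domain of injectivity.\<close>
  have "{t4..t1 + 2 * pi} = insert (t1 + 2 * pi) {t4..<t1 + 2 * pi}"
    using assms by auto
  then have F2: "F2 = cis ` insert t1 {t4..<t1 + 2 * pi}"
    by (simp add: F2_def cis_period)
  have Int: "cis ` A \<inter> cis ` B = cis ` (A \<inter> B)" if "A \<subseteq> ?I" "B \<subseteq> ?I" for A B
    using inj_on_image_Int[OF inj that] ..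
  have sub: "{t1..t2} \<subseteq> ?I" "{t3..t4} \<subseteq> ?I" "{t2..t3} \<subseteq> ?I" "insert t1 {t4..<t1 + 2 * pi} \<subseteq> ?I"
    using assms by auto
  show "F1 \<inter> F2 = {}"
    unfolding F1_def F2 Int[OF sub(3,4)] using assms by auto
  have "{t1..t2} \<inter> insert t1 {t4..<t1 + 2 * pi} = {t1}" using assms by auto
  then show "S1 \<inter> F2 = {cis t1}"
    unfolding S1_def F2 Int[OF sub(1,4)] by simp
  have "{t1..t2} \<inter> {t2..t3} = {t2}" using assms by auto
  then show "S1 \<inter> F1 = {cis t2}"
    unfolding S1_def F1_def Int[OF sub(1,3)] by simp
  have "{t3..t4} \<inter> {t2..t3} = {t3}" using assms by auto
  then show "S2 \<inter> F1 = {cis t3}"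
    unfolding S2_def F1_def Int[OF sub(2,3)] by simp
  have "{t3..t4} \<inter> insert t1 {t4..<t1 + 2 * pi} = {t4}" using assms by auto
  then show "S2 \<inter> F2 = {cis t4}"
    unfolding S2_def F2 Int[OF sub(2,4)] by simp
  show "S1 \<subseteq> sphere 0 1" "S2 \<subseteq> sphere 0 1"
    by (auto simp: S1_def S2_def)
  have "sphere 0 1 - (S1 \<union> S2) = cis ` (?I - ({t1..t2} \<union> {t3..t4}))"
    unfolding S1_def S2_def cis_image_period[of t1, symmetric] image_Un[symmetric]
    using sub by (intro inj_on_image_set_diff[OF inj, symmetric]) auto
  also have "?I - ({t1..t2} \<union> {t3..t4}) = {t2<..<t3} \<union> {t4<..<t1 + 2 * pi}"
    using assms by auto
  finally show "closure (sphere 0 1 - (S1 \<union> S2)) = F1 \<union> F2"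
    using assms by (simp add: image_Un closure_open_arc F1_def F2_def)
qed

text \<open>
  By invariance of domain the image of the open disc is open, hence inside the open disc; the same
  holds for the inverse map.
\<close>

lemma disc_homeomorphism_boundary:
  fixes \<phi> :: "complex \<Rightarrow> complex"
  assumes "homeomorphic_map (top_of_set (cball 0 1)) (top_of_set (cball 0 1)) \<phi>"
  shows "\<phi> ` sphere 0 1 = sphere 0 1"
proof -
  have into: "f ` ball 0 1 \<subseteq> ball 0 1"
    if f: "homeomorphic_map (top_of_set (cball 0 1)) (top_of_set (cball 0 1)) f"
    for f :: "complex \<Rightarrow> complex"
  proof -
    have c: "continuous_on (cball 0 1) f" and i: "inj_on f (cball 0 1)"
      and s: "f ` cball 0 1 = cball 0 1"
      using f by (auto simp: homeomorphic_eq_everything_map)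
    have "open (f ` ball 0 1)"
      by (intro invariance_of_domain)
         (auto intro: continuous_on_subset[OF c] inj_on_subset[OF i])
    moreover have "f ` ball 0 1 \<subseteq> cball 0 1" using s ball_subset_cball by blast
    ultimately show ?thesis by (metis interior_cball interior_maximal)
  qed
  obtain \<psi> where "homeomorphic_maps (top_of_set (cball 0 1)) (top_of_set (cball 0 1)) \<phi> \<psi>"
    using assms homeomorphic_map_maps by blast
  then have \<psi>: "homeomorphic_map (top_of_set (cball 0 1)) (top_of_set (cball 0 1)) \<psi>"
    and inv: "\<And>x. x \<in> cball 0 1 \<Longrightarrow> \<psi> (\<phi> x) = x" "\<And>x. x \<in> cball 0 1 \<Longrightarrow> \<phi> (\<psi> x) = x"
    by (auto simp: homeomorphic_maps_map)
  have b: "\<phi> ` ball 0 1 = ball 0 1"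
  proof
    show "ball 0 1 \<subseteq> \<phi> ` ball 0 1"
    proof
      fix x :: complex assume "x \<in> ball 0 1"
      then have "\<psi> x \<in> ball 0 1" "x = \<phi> (\<psi> x)"
        using into[OF \<psi>] inv(2)[of x] by (blast, simp)
      then show "x \<in> \<phi> ` ball 0 1" by blast
    qed
  qed (use into[OF assms] in blast)
  have i: "inj_on \<phi> (cball 0 1)" and s: "\<phi> ` cball 0 1 = cball 0 1"
    using assms by (auto simp: homeomorphic_eq_everything_map)
  have "\<phi> ` sphere 0 1 = \<phi> ` (cball 0 1 - ball 0 1)"
    by (intro arg_cong[where f = "image \<phi>"]) auto
  also have "\<dots> = sphere 0 1"
    by (subst inj_on_image_set_diff[OF i]) (auto simp: b s)
  finally show ?thesis .
qed

lemma disc_homeomorphism_closure: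
  fixes \<phi> :: "complex \<Rightarrow> complex"
  assumes \<phi>: "homeomorphic_map (top_of_set (cball 0 1)) (top_of_set (cball 0 1)) \<phi>"
    and A: "A \<subseteq> cball 0 1"
  shows "\<phi> ` closure A = closure (\<phi> ` A)"
proof -
  have cl: "top_of_set (cball (0::complex) 1) closure_of B = closure B" if "B \<subseteq> cball 0 1" for B
    using that closure_minimal[OF that closed_cball]
    by (simp add: closure_of_subtopology inf_absorb2)
  have "\<phi> ` A \<subseteq> cball 0 1"
    using homeomorphic_imp_surjective_map[OF \<phi>] A by auto
  then show ?thesis
    using homeomorphic_map_closure_of[OF \<phi>, of A] A by (simp add: cl)
qed

lemma connected_in_disjoint_closed:
  assumes "connected C" "C \<subseteq> A \<union> B" "closed A" "closed B" "A \<inter> B = {}"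
  shows "C \<subseteq> A \<or> C \<subseteq> B"
  using connected_closedD[OF assms(1), of A B] assms(2-5) by blast

section \<open>The directions of the two arrows of an edge\<close>

lemma tau_delta_delta_tau_word: "word_eq [\<tau>, \<delta>, \<delta>, \<tau>] []"
proof -
  have "word_eq ([\<tau>] @ [\<delta>, \<delta>] @ [\<tau>]) ([\<tau>] @ [] @ [\<tau>])"
    by (intro word_eq.append word_eq.refl word_eq.delta_sq)
  then show ?thesis using word_eq.trans[OF _ word_eq.tau_sq] by simp
qed

text \<open>
  The alternatives in the hypothesis are the identity, the reversal of both arrows, the exchange of
  the arrows, and both together. The words \<open>\<delta>\<delta>\<close> and \<open>\<tau>\<delta>\<delta>\<tau>\<close>, which exchange the arrows without and
  with a reversal, generate this four-group.
\<close>

lemma klein_four_words: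
  fixes c c' :: "which_arrow \<times> tip \<Rightarrow> 'a"
  assumes
    "c (ArrowA, Tail) = c' (ArrowA, Tail) \<and> c (ArrowA, Head) = c' (ArrowA, Head) \<and>
       c (ArrowB, Tail) = c' (ArrowB, Tail) \<and> c (ArrowB, Head) = c' (ArrowB, Head) \<or>
     c (ArrowA, Tail) = c' (ArrowA, Head) \<and> c (ArrowA, Head) = c' (ArrowA, Tail) \<and>
       c (ArrowB, Tail) = c' (ArrowB, Head) \<and> c (ArrowB, Head) = c' (ArrowB, Tail) \<or>
     c (ArrowA, Tail) = c' (ArrowB, Tail) \<and> c (ArrowA, Head) = c' (ArrowB, Head) \<and>
       c (ArrowB, Tail) = c' (ArrowA, Tail) \<and> c (ArrowB, Head) = c' (ArrowA, Head) \<or>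
     c (ArrowA, Tail) = c' (ArrowB, Head) \<and> c (ArrowA, Head) = c' (ArrowB, Tail) \<and>
       c (ArrowB, Tail) = c' (ArrowA, Head) \<and> c (ArrowB, Head) = c' (ArrowA, Tail)"
  shows "\<exists>u. of_word u = frakS_one \<and> (\<forall>x. c x = c' (redraw_word u x))"
proof -
  have one: "of_word u = frakS_one" if "word_eq u []" for u
    using that by (simp add: frakS_one_def frakS.abs_eq_iff)
  have "word_eq ([\<delta>, \<delta>] @ [\<tau>, \<delta>, \<delta>, \<tau>]) ([] @ [])"
    by (intro word_eq.append word_eq.delta_sq tau_delta_delta_tau_word)
  then have W: "of_word [] = frakS_one" "of_word [\<delta>, \<delta>] = frakS_one"
      "of_word [\<tau>, \<delta>, \<delta>, \<tau>] = frakS_one" "of_word [\<delta>, \<delta>, \<tau>, \<delta>, \<delta>, \<tau>] = frakS_one"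
    by (auto intro!: one word_eq.refl word_eq.delta_sq tau_delta_delta_tau_word)
  have all: "(\<forall>x. c x = c' (f x)) \<longleftrightarrow>
      c (ArrowA, Tail) = c' (f (ArrowA, Tail)) \<and> c (ArrowA, Head) = c' (f (ArrowA, Head)) \<and>
      c (ArrowB, Tail) = c' (f (ArrowB, Tail)) \<and> c (ArrowB, Head) = c' (f (ArrowB, Head))" for f
  proof (intro iffI allI)
    fix x
    assume "c (ArrowA, Tail) = c' (f (ArrowA, Tail)) \<and> c (ArrowA, Head) = c' (f (ArrowA, Head)) \<and>
      c (ArrowB, Tail) = c' (f (ArrowB, Tail)) \<and> c (ArrowB, Head) = c' (f (ArrowB, Head))"
    then show "c x = c' (f x)"
      by (cases x; cases "fst x"; cases "snd x") auto
  qed auto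
  show ?thesis
    using assms
  proof (elim disjE, goal_cases)
    case 1
    then show ?case by (intro exI[of _ "[]"]) (simp only: all W, simp add: redraw_word_def)
  next
    case 2
    then show ?case
      by (intro exI[of _ "[\<delta>, \<delta>, \<tau>, \<delta>, \<delta>, \<tau>]"]) (simp only: all W, simp add: redraw_word_def)
  next
    case 3
    then show ?case by (intro exI[of _ "[\<delta>, \<delta>]"]) (simp only: all W, simp add: redraw_word_def)
  next
    case 4
    then show ?case by (intro exI[of _ "[\<tau>, \<delta>, \<delta>, \<tau>]"]) (simp only: all W, simp add: redraw_word_def)
  qed
qed

text \<open>
  A comparison of the two parametrisations is a homeomorphism \<open>\<phi>\<close> of the disc. It permutes the two
  segments, and it permutes the closures of the two complementary arcs. These two choices are
  independent and determine where the four corners go, which gives the four cases of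
  \<open>klein_four_words\<close>.
\<close>

lemma edge_arrows_unique:
  assumes "edge_arrows G e c" "edge_arrows G e c'"
  shows "\<exists>u. of_word u = frakS_one \<and> (\<forall>x. c x = c' (redraw_word u x))"
proof -
  let ?D = "top_of_set (cball (0::complex) 1)"
  obtain h t1 t2 t3 t4 where h: "disc_param (surf G) e h"
    and t: "t1 < t2" "t2 < t3" "t3 < t4" "t4 < t1 + 2 * pi"
    and seg: "segments_of_edge G e = {(\<lambda>t. h (cis t)) ` {t1..t2}, (\<lambda>t. h (cis t)) ` {t3..t4}}"
    and c: "c (ArrowA, Tail) = h (cis t1)" "c (ArrowA, Head) = h (cis t2)"
      "c (ArrowB, Tail) = h (cis t3)" "c (ArrowB, Head) = h (cis t4)"
    using assms(1) unfolding edge_arrows_def by - (elim exE conjE, rule that)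
  obtain h' t1' t2' t3' t4' where h': "disc_param (surf G) e h'"
    and t': "t1' < t2'" "t2' < t3'" "t3' < t4'" "t4' < t1' + 2 * pi"
    and seg': "segments_of_edge G e = {(\<lambda>t. h' (cis t)) ` {t1'..t2'}, (\<lambda>t. h' (cis t)) ` {t3'..t4'}}"
    and c': "c' (ArrowA, Tail) = h' (cis t1')" "c' (ArrowA, Head) = h' (cis t2')"
      "c' (ArrowB, Tail) = h' (cis t3')" "c' (ArrowB, Head) = h' (cis t4')"
    using assms(2) unfolding edge_arrows_def by - (elim exE conjE, rule that)
  define S1 S2 F1 F2 where "S1 = cis ` {t1..t2}" "S2 = cis ` {t3..t4}"
    "F1 = cis ` {t2..t3}" "F2 = cis ` {t4..t1 + 2 * pi}"
  define S1' S2' F1' F2' where "S1' = cis ` {t1'..t2'}" "S2' = cis ` {t3'..t4'}"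
    "F1' = cis ` {t2'..t3'}" "F2' = cis ` {t4'..t1' + 2 * pi}"
  note arcs = circle_four_arcs[OF t, folded S1_S2_F1_F2_def]
  note arcs' = circle_four_arcs[OF t', folded S1'_S2'_F1'_F2'_def]
  have closed: "closed F1" "closed F2" "closed F1'" "closed F2'"
    unfolding S1_S2_F1_F2_def S1'_S2'_F1'_F2'_def
    by (intro compact_imp_closed compact_continuous_image continuous_intros compact_Icc)+
  have conn: "connected F1" "connected F2"
    unfolding S1_S2_F1_F2_def by (intro connected_continuous_image continuous_intros connected_Icc)+
  have F_sub: "F1 \<subseteq> cball 0 1" "F2 \<subseteq> cball 0 1"
    unfolding S1_S2_F1_F2_def by auto

  obtain g where g: "homeomorphic_maps ?D (subtopology (surf G) e) h' g"
    using h' unfolding disc_param_def homeomorphic_map_maps by blast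
  define \<phi> where "\<phi> = g \<circ> h"
  have \<phi>: "homeomorphic_map ?D ?D \<phi>"
    unfolding \<phi>_def using h g
    by (intro homeomorphic_map_compose) (auto simp: disc_param_def homeomorphic_maps_map)
  have e: "h ` cball 0 1 = topspace (subtopology (surf G) e)"
    using h homeomorphic_imp_surjective_map[of ?D "subtopology (surf G) e" h]
    by (simp add: disc_param_def)
  have h'\<phi>: "h' (\<phi> z) = h z" if "z \<in> cball 0 1" for z
    using g e that unfolding \<phi>_def homeomorphic_maps_map by fastforce
  have inj': "inj_on h' (cball 0 1)"
    using h' by (auto simp: disc_param_def homeomorphic_eq_everything_map)
  have inj: "inj_on \<phi> (cball 0 1)" and surj: "\<phi> ` cball 0 1 = cball 0 1"
    using \<phi> by (auto simp: homeomorphic_eq_everything_map)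
  have cont: "continuous_on (cball 0 1) \<phi>"
    using \<phi> by (auto simp: homeomorphic_eq_everything_map)

  have S_sub: "S1 \<subseteq> cball 0 1" "S2 \<subseteq> cball 0 1" "S1' \<subseteq> cball 0 1" "S2' \<subseteq> cball 0 1"
    using arcs(7,8) arcs'(7,8) by (auto simp: subset_iff)
  have hS: "h ` S = h' ` \<phi> ` S" if "S \<subseteq> cball 0 1" for S
    using h'\<phi> that by (force simp: image_image)
  have "{h ` S1, h ` S2} = {h' ` S1', h' ` S2'}"
    using seg seg' by (simp add: S1_S2_F1_F2_def S1'_S2'_F1'_F2'_def image_image)
  then have "{h' ` \<phi> ` S1, h' ` \<phi> ` S2} = {h' ` S1', h' ` S2'}"
    unfolding hS[OF S_sub(1)] hS[OF S_sub(2)] .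
  moreover have "h' ` A = h' ` B \<longleftrightarrow> A = B" if "A \<subseteq> cball 0 1" "B \<subseteq> cball 0 1" for A B
    using inj_on_image_eq_iff[OF inj' that] .
  moreover have "\<phi> ` S1 \<subseteq> cball 0 1" "\<phi> ` S2 \<subseteq> cball 0 1"
    using S_sub surj by blast+
  ultimately have S: "\<phi> ` S1 = S1' \<and> \<phi> ` S2 = S2' \<or> \<phi> ` S1 = S2' \<and> \<phi> ` S2 = S1'"
    using S_sub unfolding doubleton_eq_iff by simp
  \<comment> \<open>The \<open>F\<close> arcs form the closure of the complement of the segments in the circle.\<close>
  have "\<phi> ` (F1 \<union> F2) = closure (\<phi> ` (sphere 0 1 - (S1 \<union> S2)))"
    unfolding arcs(1)[symmetric] by (rule disc_homeomorphism_closure[OF \<phi>]) auto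
  also have "\<phi> ` (sphere 0 1 - (S1 \<union> S2)) = sphere 0 1 - (S1' \<union> S2')"
    using S S_sub disc_homeomorphism_boundary[OF \<phi>]
    by (subst inj_on_image_set_diff[OF inj]) (auto simp: image_Un)
  finally have F_Un: "\<phi> ` F1 \<union> \<phi> ` F2 = F1' \<union> F2'"
    by (simp add: arcs'(1) image_Un)
  have "connected (\<phi> ` F1)" "connected (\<phi> ` F2)"
    using F_sub by (auto intro!: connected_continuous_image conn intro: continuous_on_subset[OF cont])
  then have F_alt: "\<phi> ` F1 \<subseteq> F1' \<or> \<phi> ` F1 \<subseteq> F2'" "\<phi> ` F2 \<subseteq> F1' \<or> \<phi> ` F2 \<subseteq> F2'"
    using F_Un by (intro connected_in_disjoint_closed closed arcs'(2); blast)+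
  have ne: "F1' \<noteq> {}" "F2' \<noteq> {}"
    using arcs'(3,4) by auto
  have F: "\<phi> ` F1 \<subseteq> F1' \<and> \<phi> ` F2 \<subseteq> F2' \<or> \<phi> ` F1 \<subseteq> F2' \<and> \<phi> ` F2 \<subseteq> F1'"
    using F_alt F_Un ne arcs'(2) by blast
  \<comment> \<open>Each arrow end is the only point common to its segment and its \<open>F\<close> arc.\<close>
  have corner: "\<phi> (cis t1) \<in> \<phi> ` S1 \<inter> \<phi> ` F2" "\<phi> (cis t2) \<in> \<phi> ` S1 \<inter> \<phi> ` F1"
    "\<phi> (cis t3) \<in> \<phi> ` S2 \<inter> \<phi> ` F1" "\<phi> (cis t4) \<in> \<phi> ` S2 \<inter> \<phi> ` F2"
    using arcs(3-6) by blast+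
  have c_eq: "c (ArrowA, Tail) = h' (\<phi> (cis t1))" "c (ArrowA, Head) = h' (\<phi> (cis t2))"
      "c (ArrowB, Tail) = h' (\<phi> (cis t3))" "c (ArrowB, Head) = h' (\<phi> (cis t4))"
    by (simp_all add: c h'\<phi>)
  have point: "\<phi> z = w" if "\<phi> z \<in> \<phi> ` A \<inter> \<phi> ` B" "\<phi> ` A = A'" "\<phi> ` B \<subseteq> B'" "A' \<inter> B' = {w}" for z w A B A' B'
    using that by blast
  show ?thesis
  proof (rule klein_four_words, unfold c_eq c')
    from S F show "h' (\<phi> (cis t1)) = h' (cis t1') \<and> h' (\<phi> (cis t2)) = h' (cis t2') \<and>
        h' (\<phi> (cis t3)) = h' (cis t3') \<and> h' (\<phi> (cis t4)) = h' (cis t4') \<or>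
      h' (\<phi> (cis t1)) = h' (cis t2') \<and> h' (\<phi> (cis t2)) = h' (cis t1') \<and>
        h' (\<phi> (cis t3)) = h' (cis t4') \<and> h' (\<phi> (cis t4)) = h' (cis t3') \<or>
      h' (\<phi> (cis t1)) = h' (cis t3') \<and> h' (\<phi> (cis t2)) = h' (cis t4') \<and>
        h' (\<phi> (cis t3)) = h' (cis t1') \<and> h' (\<phi> (cis t4)) = h' (cis t2') \<or>
      h' (\<phi> (cis t1)) = h' (cis t4') \<and> h' (\<phi> (cis t2)) = h' (cis t3') \<and>
        h' (\<phi> (cis t3)) = h' (cis t2') \<and> h' (\<phi> (cis t4)) = h' (cis t1')"
    proof (elim disjE conjE, goal_cases)
      case 1
      with point[OF corner(1) 1(1,4) arcs'(3)] point[OF corner(2) 1(1,3) arcs'(4)]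
        point[OF corner(3) 1(2,3) arcs'(5)] point[OF corner(4) 1(2,4) arcs'(6)]
      show ?case by simp
    next
      case 2
      with point[OF corner(1) 2(1,4) arcs'(4)] point[OF corner(2) 2(1,3) arcs'(3)]
        point[OF corner(3) 2(2,3) arcs'(6)] point[OF corner(4) 2(2,4) arcs'(5)]
      show ?case by simp
    next
      case 3
      with point[OF corner(1) 3(1,4) arcs'(6)] point[OF corner(2) 3(1,3) arcs'(5)]
        point[OF corner(3) 3(2,3) arcs'(4)] point[OF corner(4) 3(2,4) arcs'(3)]
      show ?case by simp
    next
      case 4
      with point[OF corner(1) 4(1,4) arcs'(5)] point[OF corner(2) 4(1,3) arcs'(6)]
        point[OF corner(3) 4(2,3) arcs'(3)] point[OF corner(4) 4(2,4) arcs'(4)]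
      show ?case by simp
    qed
  qed
qed

section \<open>Words acting on arrow presentations\<close>

lemma redraw_word_Nil [simp]: "redraw_word [] = id"
  and redraw_word_Cons: "redraw_word (g # w) = redraw g \<circ> redraw_word w"
  and redraw_word_append: "redraw_word (u @ w) = redraw_word u \<circ> redraw_word w"
  by (simp_all add: redraw_word_def id_def comp_def fun_eq_iff)

text \<open>
  \<open>rev w\<close> represents the inverse of \<open>w\<close> in the group, but \<open>\<delta>\<close> permutes the arrow ends with order 4,
  so inverting the permutation exactly takes \<open>\<delta>\<delta>\<delta>\<close> in place of \<open>\<delta>\<close>.
\<close>

lemma inverse_word:
  "\<exists>u. word_eq (u @ w) [] \<and> redraw_word (u @ w) = id \<and> redraw_word (w @ u) = id"
proof (induction w)
  case Nil
  show ?case by (intro exI[of _ "[]"]) (simp add: word_eq.refl)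
next
  case (Cons g w)
  then obtain u where u: "word_eq (u @ w) []" "redraw_word (u @ w) = id" "redraw_word (w @ u) = id"
    by blast
  have "word_eq ([\<delta>, \<delta>] @ [\<delta>, \<delta>]) ([] @ [])"
    by (intro word_eq.append word_eq.delta_sq)
  then have 4: "word_eq [\<delta>, \<delta>, \<delta>, \<delta>] []" by simp
  define v where "v = (case g of \<delta> \<Rightarrow> [\<delta>, \<delta>, \<delta>] | \<tau> \<Rightarrow> [\<tau>])"
  have v: "word_eq (v @ [g]) []"
    using 4 word_eq.tau_sq by (cases g) (auto simp: v_def)
  have v_id: "redraw_word v (redraw g x) = x" "redraw g (redraw_word v x) = x" for x
    by (cases g; cases x; cases "fst x"; cases "snd x"; simp add: v_def redraw_word_def)+
  have "word_eq (u @ (v @ [g]) @ w) (u @ [] @ w)"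
    by (intro word_eq.append word_eq.refl v)
  then have "word_eq ((u @ v) @ g # w) []"
    using word_eq.trans[OF _ u(1)] by simp
  moreover have "redraw_word u (redraw_word w x) = x" "redraw_word w (redraw_word u x) = x" for x
    using fun_cong[OF u(2), of x] fun_cong[OF u(3), of x] by (simp_all add: redraw_word_append)
  then have "redraw_word ((u @ v) @ g # w) = id" "redraw_word ((g # w) @ (u @ v)) = id"
    by (simp_all only: redraw_word_append redraw_word_Cons fun_eq_iff comp_apply v_id id_apply) simp_all
  ultimately show ?case by blast
qed

lemma surj_redraw_word: "surj (redraw_word w)"
  using inverse_word[of w] by (metis redraw_word_append comp_apply id_apply surjI)

lemma frakS_group_simps:
  "frakS_mult frakS_one x = x" "frakS_mult x frakS_one = x"
  "frakS_mult (frakS_mult x y) z = frakS_mult x (frakS_mult y z)"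
  "frakS_mult (inv\<^bsub>frakS_group\<^esub> x) x = frakS_one" "frakS_mult x (inv\<^bsub>frakS_group\<^esub> x) = frakS_one"
proof -
  interpret group frakS_group by (rule group_frakS_group)
  show "frakS_mult frakS_one x = x" "frakS_mult x frakS_one = x"
    "frakS_mult (frakS_mult x y) z = frakS_mult x (frakS_mult y z)"
    "frakS_mult (inv\<^bsub>frakS_group\<^esub> x) x = frakS_one" "frakS_mult x (inv\<^bsub>frakS_group\<^esub> x) = frakS_one"
    using l_one[of x] r_one[of x] m_assoc[of x y z] l_inv[of x] r_inv[of x]
    by (simp_all add: frakS_group_def)
qed

lemma of_word_append: "of_word (u @ v) = frakS_mult (of_word u) (of_word v)"
  by (simp add: frakS_mult.abs_eq)

lemma of_word_Nil: "of_word [] = frakS_one"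
  by (simp add: frakS_one_def)

definition redraw_ends :: "('l \<Rightarrow> gen list) \<Rightarrow> 'l endpoint \<Rightarrow> 'l endpoint" where
  "redraw_ends w = (\<lambda>(l, x). (l, redraw_word (w l) x))"

lemma gaps_apply_words: "gaps (apply_words w P) = image (redraw_ends w) ` gaps P"
  by (simp add: apply_words_def redraw_ends_def)

lemma labels_apply_words [simp]: "labels (apply_words w P) = labels P"
  and bare_circles_apply_words [simp]: "bare_circles (apply_words w P) = bare_circles P"
  by (simp_all add: apply_words_def)

lemma redraw_ends_redraw_ends:
  "redraw_ends u ` redraw_ends w ` A = redraw_ends (\<lambda>l. u l @ w l) ` A"
  by (auto simp: redraw_ends_def redraw_word_append image_image intro!: image_cong)

lemma apply_words_append: "apply_words u (apply_words w P) = apply_words (\<lambda>l. u l @ w l) P"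
  by (intro arrow_presentation.equality)
     (simp_all add: gaps_apply_words image_image redraw_ends_redraw_ends[unfolded image_image])

lemma apply_words_trivial:
  assumes "\<And>l. redraw_word (w l) = id"
  shows "apply_words w P = P"
proof -
  have "redraw_ends w = id"
    by (simp add: redraw_ends_def assms fun_eq_iff)
  then show ?thesis
    by (intro arrow_presentation.equality) (simp_all add: gaps_apply_words)
qed

section \<open>Relabelling and uniqueness of arrow presentations\<close>

definition relabel :: "('l \<Rightarrow> 'm) \<Rightarrow> 'l arrow_presentation \<Rightarrow> 'm arrow_presentation" where
  "relabel \<rho> P = \<lparr>labels = \<rho> ` labels P, gaps = image (map_prod \<rho> id) ` gaps P,
     bare_circles = bare_circles P\<rparr>"

lemma apply_words_relabel: "apply_words w (relabel \<rho> P) = relabel \<rho> (apply_words (w \<circ> \<rho>) P)"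
proof -
  have "redraw_ends w ` map_prod \<rho> id ` A = map_prod \<rho> id ` redraw_ends (w \<circ> \<rho>) ` A" for A
    by (auto simp: redraw_ends_def image_image intro!: image_cong)
  then have "image (redraw_ends w) ` image (map_prod \<rho> id) ` gaps P =
      image (map_prod \<rho> id) ` image (redraw_ends (w \<circ> \<rho>)) ` gaps P"
    unfolding image_image[of "image (redraw_ends w)" "image (map_prod \<rho> id)"]
      image_image[of "image (map_prod \<rho> id)" "image (redraw_ends (w \<circ> \<rho>))"] by simp
  then show ?thesis
    by (intro arrow_presentation.equality) (simp_all add: gaps_apply_words relabel_def)
qed

lemma relabel_relabel:
  assumes "gaps P \<subseteq> Pow (endpoints P)" and "\<And>l. l \<in> labels P \<Longrightarrow> \<rho>' (\<rho> l) = l"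
  shows "relabel \<rho>' (relabel \<rho> P) = P"
proof -
  have "map_prod \<rho>' id ` map_prod \<rho> id ` A = A" if "A \<in> gaps P" for A
  proof -
    have "fst p \<in> labels P" if "p \<in> A" for p
      using that \<open>A \<in> gaps P\<close> assms(1) by (fastforce simp: endpoints_def)
    then have "map_prod \<rho>' id ` map_prod \<rho> id ` A = id ` A"
      unfolding image_image using assms(2) by (intro image_cong) auto
    then show ?thesis by simp
  qed
  then have "image (map_prod \<rho>' id) ` image (map_prod \<rho> id) ` gaps P = id ` gaps P"
    unfolding image_image[of "image (map_prod \<rho>' id)" "image (map_prod \<rho> id)"]
    by (intro image_cong) simp_all
  moreover have "\<rho>' ` \<rho> ` labels P = id ` labels P"
    unfolding image_image using assms(2) by (intro image_cong) auto
  ultimately show ?thesis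
    by (intro arrow_presentation.equality) (simp_all add: relabel_def)
qed

text \<open>
  The value that \<open>presents\<close> forces on the gaps once the positions \<open>c\<close> of the arrow ends are chosen.
\<close>

definition gap_ends :: "'a ribbon \<Rightarrow> 'l set \<Rightarrow> ('l endpoint \<Rightarrow> 'a) \<Rightarrow> 'l endpoint set set" where
  "gap_ends G L c = {{p \<in> L \<times> UNIV. c p \<in> surf G closure_of K} | K. K \<in> free_arcs G} - {{}}"

lemma presents_iff_gap_ends:
  "presents P G lab \<longleftrightarrow> bij_betw lab (labels P) (edges G) \<and>
     (\<exists>c. (\<forall>l \<in> labels P. edge_arrows G (lab l) (\<lambda>x. c (l, x))) \<and>
          gaps P = gap_ends G (labels P) c) \<and>
     bare_circles P = card {v \<in> verts G. v \<inter> \<Union>(edges G) = {}}"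
  by (simp add: presents_def gap_ends_def endpoints_def)

lemma presents_gaps_subset: "presents P G lab \<Longrightarrow> gaps P \<subseteq> Pow (endpoints P)"
  by (auto simp: presents_def)

lemma presents_cong:
  assumes "presents P G lab" "\<And>l. l \<in> labels P \<Longrightarrow> lab l = lab' l"
  shows "presents P G lab'"
  using assms(1) unfolding presents_def by (simp add: assms(2) cong: bij_betw_cong)

lemma gap_ends_reindex:
  assumes "\<sigma> ` (L \<times> UNIV) = L' \<times> UNIV" and "\<And>p. p \<in> L \<times> UNIV \<Longrightarrow> c p = c' (\<sigma> p)"
  shows "gap_ends G L' c' = image \<sigma> ` gap_ends G L c"
proof -
  have eq: "{q \<in> L' \<times> UNIV. c' q \<in> T} = \<sigma> ` {p \<in> L \<times> UNIV. c p \<in> T}" for T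
  proof (intro equalityI subsetI)
    fix q assume q: "q \<in> {q \<in> L' \<times> UNIV. c' q \<in> T}"
    then obtain p where "p \<in> L \<times> UNIV" "q = \<sigma> p"
      unfolding assms(1)[symmetric] by blast
    then show "q \<in> \<sigma> ` {p \<in> L \<times> UNIV. c p \<in> T}"
      using q assms(2) by auto
  next
    fix q assume "q \<in> \<sigma> ` {p \<in> L \<times> UNIV. c p \<in> T}"
    then obtain p where "p \<in> L \<times> UNIV" "c p \<in> T" "q = \<sigma> p" by blast
    then show "q \<in> {q \<in> L' \<times> UNIV. c' q \<in> T}"
      using assms(2)[of p] imageI[of p "L \<times> UNIV" \<sigma>] unfolding assms(1) by simp
  qed
  have diff: "image \<sigma> ` (\<A> - {{}}) = image \<sigma> ` \<A> - {{}}" for \<A>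
    by auto
  show ?thesis
    unfolding gap_ends_def Setcompr_eq_image diff eq image_image ..
qed

lemma presents_relabel:
  assumes "presents P G lab" and \<rho>: "bij_betw \<rho> (labels P) L'"
    and lab': "\<And>l. l \<in> labels P \<Longrightarrow> lab' (\<rho> l) = lab l"
  shows "presents (relabel \<rho> P) G lab'"
proof -
  obtain c where c: "\<forall>l \<in> labels P. edge_arrows G (lab l) (\<lambda>x. c (l, x))"
    "gaps P = gap_ends G (labels P) c"
    using assms(1) unfolding presents_iff_gap_ends by blast
  define \<rho>' where "\<rho>' = the_inv_into (labels P) \<rho>"
  define c' where "c' = c \<circ> map_prod \<rho>' id"
  have \<rho>': "\<rho>' (\<rho> l) = l" if "l \<in> labels P" for l
    using that \<rho> by (simp add: \<rho>'_def the_inv_into_f_f bij_betw_def)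
  have L': "\<rho> ` labels P = L'"
    using \<rho> by (simp add: bij_betw_def)
  have "gap_ends G L' c' = image (map_prod \<rho> id) ` gap_ends G (labels P) c"
    by (intro gap_ends_reindex) (auto simp: L'[symmetric] c'_def \<rho>' image_iff)
  moreover have "bij_betw (lab' \<circ> \<rho>) (labels P) (edges G)"
    using assms(1) lab' by (simp add: presents_def cong: bij_betw_cong)
  then have "bij_betw lab' L' (edges G)"
    using \<rho> bij_betw_comp_iff by blast
  moreover have "edge_arrows G (lab' (\<rho> l)) (\<lambda>x. c' (\<rho> l, x))" if "l \<in> labels P" for l
    using c(1) that by (simp add: c'_def \<rho>' lab')
  ultimately show ?thesis
    using assms(1) c(2) unfolding presents_iff_gap_ends
    by (intro conjI exI[of _ c']) (auto simp: relabel_def L'[symmetric])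
qed

text \<open>
  The positions of the arrow ends determine the gaps, and at each edge those positions are determined
  up to a permutation that a trivial word performs.
\<close>

lemma presents_unique:
  assumes "presents P G lab" "presents Q G lab" "labels Q = labels P"
  shows "\<exists>u. (\<forall>l. of_word (u l) = frakS_one) \<and> Q = apply_words u P"
proof -
  let ?L = "labels P"
  obtain c where c: "\<forall>l \<in> ?L. edge_arrows G (lab l) (\<lambda>x. c (l, x))" "gaps P = gap_ends G ?L c"
    using assms(1) unfolding presents_iff_gap_ends by blast
  obtain c' where c': "\<forall>l \<in> ?L. edge_arrows G (lab l) (\<lambda>x. c' (l, x))" "gaps Q = gap_ends G ?L c'"
    using assms(2,3) unfolding presents_iff_gap_ends by auto
  have "\<exists>u. of_word u = frakS_one \<and> (l \<in> ?L \<longrightarrow> (\<forall>x. c (l, x) = c' (l, redraw_word u x)))" for l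
    using edge_arrows_unique[of G "lab l" "\<lambda>x. c (l, x)" "\<lambda>x. c' (l, x)"] c(1) c'(1) of_word_Nil
    by (cases "l \<in> ?L") auto
  then obtain u where u: "\<And>l. of_word (u l) = frakS_one"
    "\<And>l x. l \<in> ?L \<Longrightarrow> c (l, x) = c' (l, redraw_word (u l) x)"
    by metis
  have "redraw_ends u ` (?L \<times> UNIV) = ?L \<times> UNIV"
  proof (intro equalityI subsetI)
    fix p assume p: "p \<in> ?L \<times> (UNIV :: (which_arrow \<times> tip) set)"
    obtain x where "snd p = redraw_word (u (fst p)) x"
      using surj_redraw_word[of "u (fst p)"] by (metis surjD)
    then have "p = redraw_ends u (fst p, x)"
      by (simp add: redraw_ends_def prod_eq_iff)
    with p show "p \<in> redraw_ends u ` (?L \<times> UNIV)" by auto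
  qed (auto simp: redraw_ends_def)
  then have "gap_ends G ?L c' = image (redraw_ends u) ` gap_ends G ?L c"
    by (intro gap_ends_reindex) (auto simp: redraw_ends_def u(2))
  moreover have "bare_circles Q = bare_circles P"
    using assms by (simp add: presents_def)
  ultimately have "Q = apply_words u P"
    using assms(3) c(2) c'(2) by (intro arrow_presentation.equality) (simp_all add: gaps_apply_words)
  with u(1) show ?thesis by blast
qed

section \<open>Composing and inverting twisted duals\<close>

lemma labels_presents_self: "presents P G (\<lambda>e. e) \<Longrightarrow> labels P = edges G"
  by (simp add: presents_def bij_betw_def)

lemma presents_bij_betw: "presents P G lab \<Longrightarrow> bij_betw lab (labels P) (edges G)"
  by (simp add: presents_def)

lemma twisted_dual_bij_betw:
  assumes "twisted_dual G \<Gamma> G' \<rho>"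
  shows "bij_betw \<rho> (edges G) (edges G')"
proof -
  obtain P w where P: "presents P G (\<lambda>e. e)" "presents (apply_words w P) G' \<rho>"
    using assms unfolding twisted_dual_def by - (elim exE conjE, rule that)
  then show ?thesis
    using presents_bij_betw[OF P(2)] labels_presents_self[OF P(1)] by simp
qed

lemma twisted_dual_cong:
  assumes "twisted_dual G \<Gamma> G' \<rho>" "\<And>e. e \<in> edges G \<Longrightarrow> \<Gamma> e = \<Gamma>' e" "\<And>e. e \<in> edges G \<Longrightarrow> \<rho> e = \<rho>' e"
  shows "twisted_dual G \<Gamma>' G' \<rho>'"
proof -
  obtain P w where P: "presents P G (\<lambda>e. e)" "\<forall>e \<in> edges G. of_word (w e) = \<Gamma> e"
      "presents (apply_words w P) G' \<rho>"
    using assms(1) unfolding twisted_dual_def by - (elim exE conjE, rule that)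
  moreover have "presents (apply_words w P) G' \<rho>'"
    using P(3) by (rule presents_cong) (simp add: labels_presents_self[OF P(1)] assms(3))
  ultimately show ?thesis
    using assms(2) unfolding twisted_dual_def by (intro exI[of _ P] exI[of _ w]) simp
qed

text \<open>
  With \<open>P\<close>, \<open>w\<close> witnessing the first twisted dual and \<open>Q\<close>, \<open>v\<close> the second, \<open>Q\<close> is \<open>apply_words w P\<close>
  relabelled by \<open>\<rho>\<close> and corrected by trivial words \<open>u\<close>. Applying \<open>v\<close> to \<open>Q\<close> thus applies
  \<open>v @ u @ w\<close> to \<open>P\<close>, and the words in the middle vanish in the group.
\<close>

lemma twisted_dual_compose:
  assumes "twisted_dual G \<Gamma> G1 \<rho>" "twisted_dual G1 \<Delta> G2 \<rho>'"
  shows "twisted_dual G (\<lambda>e. frakS_mult (\<Delta> (\<rho> e)) (\<Gamma> e)) G2 (\<rho>' \<circ> \<rho>)"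
proof -
  obtain P w where P: "presents P G (\<lambda>e. e)" "\<forall>e \<in> edges G. of_word (w e) = \<Gamma> e"
      "presents (apply_words w P) G1 \<rho>"
    using assms(1) unfolding twisted_dual_def by - (elim exE conjE, rule that)
  obtain Q v where Q: "presents Q G1 (\<lambda>e. e)" "\<forall>e \<in> edges G1. of_word (v e) = \<Delta> e"
      "presents (apply_words v Q) G2 \<rho>'"
    using assms(2) unfolding twisted_dual_def by - (elim exE conjE, rule that)
  have L: "labels P = edges G" "labels Q = edges G1"
    by (rule labels_presents_self, fact)+
  have \<rho>: "bij_betw \<rho> (edges G) (edges G1)"
    by (rule twisted_dual_bij_betw, fact)
  then have \<rho>_im: "\<rho> ` edges G = edges G1"
    by (simp add: bij_betw_def)
  define \<rho>i where "\<rho>i = the_inv_into (edges G) \<rho>"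
  have \<rho>i: "\<rho>i (\<rho> e) = e" if "e \<in> edges G" for e
    using that \<rho> by (simp add: \<rho>i_def the_inv_into_f_f bij_betw_def)
  have \<rho>i_bij: "bij_betw \<rho>i (edges G1) (edges G)"
    unfolding \<rho>i_def by (rule bij_betw_the_inv_into, fact)
  have "presents (relabel \<rho> (apply_words w P)) G1 (\<lambda>e. e)"
    using P(3) by (rule presents_relabel) (use \<rho> L in simp_all)
  moreover have "labels Q = labels (relabel \<rho> (apply_words w P))"
    using L \<rho>_im by (simp add: relabel_def)
  ultimately obtain u where u: "\<And>e. of_word (u e) = frakS_one"
    and Q_eq: "Q = apply_words u (relabel \<rho> (apply_words w P))"
    using presents_unique[OF _ Q(1)] by metis
  define x where "x = (\<lambda>e. v (\<rho> e) @ u (\<rho> e) @ w e)"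
  have "apply_words v Q = relabel \<rho> (apply_words x P)"
    by (simp add: Q_eq apply_words_relabel apply_words_append x_def comp_def)
  then have rel: "presents (relabel \<rho> (apply_words x P)) G2 \<rho>'"
    using Q(3) by simp
  have "gaps (apply_words x P) \<subseteq> Pow (endpoints (apply_words x P))"
    using presents_gaps_subset[OF P(1)]
    by (force simp: gaps_apply_words endpoints_def redraw_ends_def)
  then have "relabel \<rho>i (relabel \<rho> (apply_words x P)) = apply_words x P"
    by (rule relabel_relabel) (simp add: L \<rho>i)
  moreover have "presents (relabel \<rho>i (relabel \<rho> (apply_words x P))) G2 (\<rho>' \<circ> \<rho>)"
    using rel
  proof (rule presents_relabel)
    show "bij_betw \<rho>i (labels (relabel \<rho> (apply_words x P))) (edges G)"
      using \<rho>i_bij by (simp add: relabel_def L \<rho>_im)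
  qed (auto simp: relabel_def L \<rho>i)
  ultimately have "presents (apply_words x P) G2 (\<rho>' \<circ> \<rho>)"
    by simp
  moreover have "of_word (x e) = frakS_mult (\<Delta> (\<rho> e)) (\<Gamma> e)" if "e \<in> edges G" for e
  proof -
    have "\<rho> e \<in> edges G1"
      using that \<rho>_im by blast
    then show ?thesis
      using that P(2) Q(2) by (simp add: x_def of_word_append u frakS_group_simps)
  qed
  ultimately show ?thesis
    using P(1) unfolding twisted_dual_def by (intro exI[of _ P] exI[of _ x]) simp
qed

text \<open>
  The words \<open>u e\<close> are chosen to undo \<open>w e\<close> as permutations of the arrow ends and not only in the
  group, so undoing \<open>apply_words w P\<close> returns the presentation \<open>P\<close> itself.
\<close>

lemma twisted_dual_inverse:
  assumes "twisted_dual G \<Gamma> G' \<rho>" and \<rho>': "\<And>e. e \<in> edges G \<Longrightarrow> \<rho>' (\<rho> e) = e"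
    and \<Delta>: "\<And>e. e \<in> edges G \<Longrightarrow> frakS_mult (\<Delta> (\<rho> e)) (\<Gamma> e) = frakS_one"
  shows "twisted_dual G' \<Delta> G \<rho>'"
proof -
  obtain P w where P: "presents P G (\<lambda>e. e)" "\<forall>e \<in> edges G. of_word (w e) = \<Gamma> e"
      "presents (apply_words w P) G' \<rho>"
    using assms(1) unfolding twisted_dual_def by - (elim exE conjE, rule that)
  have L: "labels P = edges G"
    by (rule labels_presents_self, fact)
  have \<rho>: "bij_betw \<rho> (edges G) (edges G')"
    by (rule twisted_dual_bij_betw, fact)
  have "\<forall>e. \<exists>u. word_eq (u @ w e) [] \<and> redraw_word (u @ w e) = id"
    using inverse_word by blast
  from choice[OF this] obtain u where
    u: "\<And>e. word_eq (u e @ w e) []" "\<And>e. redraw_word (u e @ w e) = id"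
    by blast
  have "presents (relabel \<rho> (apply_words w P)) G' (\<lambda>e. e)"
    using P(3) by (rule presents_relabel) (use \<rho> L in simp_all)
  moreover have "of_word ((u \<circ> \<rho>') e') = \<Delta> e'" if e': "e' \<in> edges G'" for e'
  proof -
    obtain e where e: "e \<in> edges G" "e' = \<rho> e"
      using e' unfolding bij_betw_imp_surj_on[OF \<rho>, symmetric] by blast
    have "frakS_mult (of_word (u e)) (\<Gamma> e) = frakS_one"
    proof -
      have "of_word (u e @ w e) = of_word []"
        using u(1) by (simp only: frakS.abs_eq_iff)
      then show ?thesis
        using e P(2) by (simp add: of_word_append of_word_Nil)
    qed
    then have "of_word (u e) = \<Delta> e'"
      using \<Delta>[OF e(1)] e(2) by (metis frakS_group_simps(2,3,5))
    then show ?thesis using \<rho>' e by simp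
  qed
  moreover have "presents (apply_words (u \<circ> \<rho>') (relabel \<rho> (apply_words w P))) G \<rho>'"
  proof -
    define z where "z = (\<lambda>e. u (\<rho>' (\<rho> e)) @ w e)"
    have "apply_words z P = apply_words (\<lambda>e. u e @ w e) P"
    proof -
      have "redraw_ends z ` A = redraw_ends (\<lambda>e. u e @ w e) ` A" if "A \<in> gaps P" for A
      proof (intro image_cong HOL.refl)
        fix p assume "p \<in> A"
        then have "fst p \<in> edges G"
          using that presents_gaps_subset[OF P(1)] L by (fastforce simp: endpoints_def)
        then show "redraw_ends z p = redraw_ends (\<lambda>e. u e @ w e) p"
          by (simp add: redraw_ends_def z_def \<rho>' case_prod_beta)
      qed
      then have "image (redraw_ends z) ` gaps P = image (redraw_ends (\<lambda>e. u e @ w e)) ` gaps P"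
        by (rule image_cong[OF HOL.refl])
      then show ?thesis
        by (intro arrow_presentation.equality) (simp_all add: gaps_apply_words)
    qed
    then have "apply_words z P = P"
      by (simp add: apply_words_trivial u(2))
    then have "apply_words (u \<circ> \<rho>') (relabel \<rho> (apply_words w P)) = relabel \<rho> P"
      by (simp add: apply_words_relabel apply_words_append z_def comp_def)
    moreover have "presents (relabel \<rho> P) G \<rho>'"
      using P(1) by (rule presents_relabel) (use \<rho> \<rho>' L in simp_all)
    ultimately show ?thesis by simp
  qed
  ultimately show ?thesis
    unfolding twisted_dual_def
    by (intro exI[of _ "relabel \<rho> (apply_words w P)"] exI[of _ "u \<circ> \<rho>'"] conjI ballI)
qed

section \<open>Isomorphisms of ribbon graphs\<close>

lemma ribbon_iso_compose:
  assumes "ribbon_iso G H f" "ribbon_iso H K g"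
  shows "ribbon_iso G K (g \<circ> f)"
proof -
  have "image (g \<circ> f) ` \<D> = image g ` image f ` \<D>" for \<D>
    by (simp add: image_image)
  then show ?thesis
    using assms unfolding ribbon_iso_def by (auto intro: homeomorphic_map_compose)
qed

lemma disc_subset_topspace:
  assumes "ribbon_graph G" "D \<in> verts G \<union> edges G"
  shows "D \<subseteq> topspace (surf G)"
proof -
  have "topspace (surf G) = \<Union>(verts G) \<union> \<Union>(edges G)"
    using assms(1) by (simp only: ribbon_graph_def)
  with assms(2) show ?thesis by blast
qed

lemma ribbon_iso_inverse:
  assumes "ribbon_iso G H f" "ribbon_graph G"
  obtains g where "ribbon_iso H G g" "\<And>x. x \<in> topspace (surf G) \<Longrightarrow> g (f x) = x"
proof -
  obtain g where g: "homeomorphic_maps (surf G) (surf H) f g"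
    using assms(1) unfolding ribbon_iso_def homeomorphic_map_maps by blast
  then have gf: "g (f x) = x" if "x \<in> topspace (surf G)" for x
    using that by (simp add: homeomorphic_maps_def)
  have gfD: "g ` f ` D = D" if "D \<in> verts G \<union> edges G" for D
  proof -
    have "(\<lambda>x. g (f x)) ` D = (\<lambda>x. x) ` D"
      using gf disc_subset_topspace[OF assms(2) that] by (intro image_cong) auto
    then show ?thesis by (simp add: image_image)
  qed
  have "image g ` image f ` \<D> = \<D>" if "\<D> \<subseteq> verts G \<union> edges G" for \<D>
  proof -
    have "(\<lambda>D. g ` f ` D) ` \<D> = (\<lambda>D. D) ` \<D>"
      using gfD that by (intro image_cong) auto
    then show ?thesis by (simp add: image_image[of "image g"])
  qed
  from this[of "verts G"] this[of "edges G"] have "ribbon_iso H G g"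
    using assms(1) g unfolding ribbon_iso_def homeomorphic_maps_map by simp
  then show thesis using gf by (rule that)
qed

lemma disc_boundary_subset: "disc_boundary X D \<subseteq> D"
proof -
  have "h ` sphere 0 1 \<subseteq> D" if "disc_param X D h" for h
  proof -
    have "h ` cball 0 1 = topspace (subtopology X D)"
      using that homeomorphic_imp_surjective_map[of "top_of_set (cball 0 1)" "subtopology X D" h]
      by (simp add: disc_param_def)
    then have "h ` sphere 0 1 \<subseteq> topspace (subtopology X D)"
      using sphere_cball by blast
    then show ?thesis by simp
  qed
  then show ?thesis by (auto simp: disc_boundary_def)
qed

context
  fixes X :: "'a topology" and Y :: "'b topology" and f
  assumes f: "homeomorphic_map X Y f"
begin

lemma homeomorphic_map_subtopology_image:
  assumes "D \<subseteq> topspace X"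
  shows "homeomorphic_map (subtopology X D) (subtopology Y (f ` D)) f"
proof (rule homeomorphic_map_subtopologies[OF f])
  have "f ` D \<subseteq> topspace Y"
    using image_mono[OF assms, of f] by (simp only: homeomorphic_imp_surjective_map[OF f])
  then show "f ` (topspace X \<inter> D) = topspace Y \<inter> f ` D"
    using assms by (simp add: inf_absorb2)
qed

lemma disc_param_image:
  assumes "disc_param X D h"
  shows "disc_param Y (f ` D) (f \<circ> h)"
proof -
  have D: "D \<subseteq> topspace X"
    using assms by (simp add: disc_param_def)
  have "f ` D \<subseteq> topspace Y"
    using image_mono[OF D, of f] by (simp only: homeomorphic_imp_surjective_map[OF f])
  moreover have "homeomorphic_map (top_of_set (cball 0 1)) (subtopology X D) h"
    using assms by (simp add: disc_param_def)
  then have "homeomorphic_map (top_of_set (cball 0 1)) (subtopology Y (f ` D)) (f \<circ> h)"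
    by (rule homeomorphic_map_compose) (rule homeomorphic_map_subtopology_image[OF D])
  ultimately show ?thesis
    by (simp add: disc_param_def)
qed

lemma connected_components_image:
  assumes "T \<subseteq> topspace X"
  shows "connected_components_of (subtopology Y (f ` T)) =
    image f ` connected_components_of (subtopology X T)"
  by (intro homeomorphic_map_connected_components_of homeomorphic_map_subtopology_image assms)

end

text \<open>
  A parametrisation of \<open>f ` D\<close> pulls back to one of \<open>D\<close> along the inverse homeomorphism.
\<close>

lemma disc_boundary_image:
  assumes f: "homeomorphic_map X Y f" and D: "D \<subseteq> topspace X"
  shows "disc_boundary Y (f ` D) = f ` disc_boundary X D"
proof
  show "f ` disc_boundary X D \<subseteq> disc_boundary Y (f ` D)"
  proof
    fix y assume "y \<in> f ` disc_boundary X D"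
    then obtain h z where h: "disc_param X D h" "z \<in> sphere 0 1" "y = f (h z)"
      unfolding disc_boundary_def by blast
    then show "y \<in> disc_boundary Y (f ` D)"
      using disc_param_image[OF f h(1)] unfolding disc_boundary_def
      by (intro UN_I[of "f \<circ> h"]) auto
  qed
  obtain g where g: "homeomorphic_maps X Y f g"
    using f unfolding homeomorphic_map_maps by blast
  then have g_map: "homeomorphic_map Y X g" and gf: "\<And>x. x \<in> topspace X \<Longrightarrow> g (f x) = x"
    by (simp_all add: homeomorphic_maps_map)
  have gfD: "g ` f ` D = D"
  proof -
    have "(\<lambda>x. g (f x)) ` D = (\<lambda>x. x) ` D"
      using gf D by (intro image_cong) auto
    then show ?thesis by (simp add: image_image)
  qed
  show "disc_boundary Y (f ` D) \<subseteq> f ` disc_boundary X D"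
  proof
    fix y assume y: "y \<in> disc_boundary Y (f ` D)"
    then obtain h z where h: "disc_param Y (f ` D) h" "z \<in> sphere 0 1" "y = h z"
      unfolding disc_boundary_def by blast
    have "disc_param X D (g \<circ> h)"
      using disc_param_image[OF g_map h(1)] by (simp add: gfD)
    then have bd: "g y \<in> disc_boundary X D"
      using h(2,3) unfolding disc_boundary_def by (intro UN_I[of "g \<circ> h"]) auto
    obtain x where x: "x \<in> D" "y = f x"
      using subsetD[OF disc_boundary_subset y] by (rule imageE)
    then have "g y = x"
      using D gf by auto
    with x(2) bd show "y \<in> f ` disc_boundary X D" by simp
  qed
qed

text \<open>
  Every ingredient of an arrow presentation (segments, free arcs, directed edge boundaries, closures)
  is topological, so the same abstract presentation serves the image graph, with the labels
  transported.
\<close>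

lemma presents_image:
  assumes G: "ribbon_graph G" and iso: "ribbon_iso G H f" and P: "presents P G lab"
  shows "presents P H (\<lambda>l. f ` lab l)"
proof -
  let ?X = "surf G" and ?Y = "surf H"
  have f: "homeomorphic_map ?X ?Y f" and verts: "verts H = image f ` verts G"
    and edges: "edges H = image f ` edges G"
    using iso by (auto simp: ribbon_iso_def)
  have inj: "inj_on f (topspace ?X)"
    using f by (rule homeomorphic_imp_injective_map)
  have V: "\<Union>(verts G) \<subseteq> topspace ?X" and E: "\<Union>(edges G) \<subseteq> topspace ?X"
    using disc_subset_topspace[OF G] by (simp_all add: Sup_le_iff)
  have "\<Union>(verts H) \<inter> \<Union>(edges H) = f ` (\<Union>(verts G) \<inter> \<Union>(edges G))"
    unfolding verts edges image_Union[symmetric] by (rule inj_on_image_Int[OF inj V E, symmetric])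
  then have segs: "segments H = image f ` segments G"
    unfolding segments_def using connected_components_image[OF f, of "\<Union>(verts G) \<inter> \<Union>(edges G)"] V
    by (simp add: le_infI1)
  have seg_sub: "s \<subseteq> topspace ?X" if "s \<in> segments G" for s
    using connected_components_of_subset[OF that[unfolded segments_def]] by simp
  have segs_edge: "segments_of_edge H (f ` e) = image f ` segments_of_edge G e" if e: "e \<in> edges G" for e
  proof -
    have "e \<subseteq> topspace ?X"
      using disc_subset_topspace[OF G] e by simp
    then have "f ` s \<subseteq> f ` e \<longleftrightarrow> s \<subseteq> e" if "s \<in> segments G" for s
      using seg_sub[OF that] by (rule inj_on_image_subset_iff[OF inj, rotated])
    then show ?thesis
      unfolding segments_of_edge_def segs by auto
  qed
  have bd: "(\<Union>v \<in> verts G. disc_boundary ?X v) \<subseteq> topspace ?X"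
  proof (rule UN_least)
    fix v assume "v \<in> verts G"
    then have "v \<subseteq> topspace ?X" using V by blast
    with disc_boundary_subset show "disc_boundary ?X v \<subseteq> topspace ?X" by (rule subset_trans)
  qed
  define B where "B = (\<Union>v \<in> verts G. disc_boundary ?X v) - \<Union>(segments G)"
  have B: "B \<subseteq> topspace ?X"
    using bd unfolding B_def by (rule subset_trans[OF Diff_subset])
  have "disc_boundary ?Y (f ` v) = f ` disc_boundary ?X v" if "v \<in> verts G" for v
    using that disc_subset_topspace[OF G] by (intro disc_boundary_image[OF f]) simp
  then have "(\<Union>v \<in> verts H. disc_boundary ?Y v) = f ` (\<Union>v \<in> verts G. disc_boundary ?X v)"
    unfolding verts by (simp add: image_UN)
  moreover have "\<Union>(segments H) = f ` \<Union>(segments G)"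
    unfolding segs by (rule image_Union[symmetric])
  moreover have "\<Union>(segments G) \<subseteq> topspace ?X"
    using seg_sub by (rule Sup_least)
  ultimately have "(\<Union>v \<in> verts H. disc_boundary ?Y v) - \<Union>(segments H) = f ` B"
    unfolding B_def using bd
    by (simp only: inj_on_image_set_diff[OF inj subset_trans[OF Diff_subset]])
  then have arcs: "free_arcs H = image f ` free_arcs G"
    unfolding free_arcs_def B_def[symmetric] using connected_components_image[OF f B] by simp
  have arc_sub: "K \<subseteq> topspace ?X" if "K \<in> free_arcs G" for K
    using connected_components_of_subset[OF that[unfolded free_arcs_def]] by simp

  have arrows: "edge_arrows H (f ` e) (f \<circ> c)" if c: "edge_arrows G e c" and e: "e \<in> edges G" for e c
  proof -
    obtain h t1 t2 t3 t4 where h: "disc_param ?X e h"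
      and t: "t1 < t2" "t2 < t3" "t3 < t4" "t4 < t1 + 2 * pi"
      and seg: "segments_of_edge G e = {(\<lambda>t. h (cis t)) ` {t1..t2}, (\<lambda>t. h (cis t)) ` {t3..t4}}"
      and c: "c (ArrowA, Tail) = h (cis t1)" "c (ArrowA, Head) = h (cis t2)"
        "c (ArrowB, Tail) = h (cis t3)" "c (ArrowB, Head) = h (cis t4)"
      using c unfolding edge_arrows_def by - (elim exE conjE, rule that)
    have "segments_of_edge H (f ` e) =
        {(\<lambda>t. (f \<circ> h) (cis t)) ` {t1..t2}, (\<lambda>t. (f \<circ> h) (cis t)) ` {t3..t4}}"
      by (simp add: segs_edge[OF e] seg image_image)
    then show ?thesis
      unfolding edge_arrows_def using disc_param_image[OF f h] t
      by (intro exI[of _ "f \<circ> h"] exI[of _ t1] exI[of _ t2] exI[of _ t3] exI[of _ t4]) (simp add: c)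
  qed
  have arrow_point: "c x \<in> topspace ?X" if arr: "edge_arrows G e c" for e c x
  proof -
    obtain h t1 t2 t3 t4 where h: "disc_param ?X e h"
      and c: "c (ArrowA, Tail) = h (cis t1)" "c (ArrowA, Head) = h (cis t2)"
        "c (ArrowB, Tail) = h (cis t3)" "c (ArrowB, Head) = h (cis t4)"
      using arr unfolding edge_arrows_def by - (elim exE conjE, rule that)
    have "h ` cball 0 1 = topspace (subtopology ?X e)"
      using h homeomorphic_imp_surjective_map[of "top_of_set (cball 0 1)" "subtopology ?X e" h]
      by (simp add: disc_param_def)
    moreover have "h (cis s) \<in> h ` cball 0 1" for s
      by (rule imageI) simp
    ultimately have "h (cis s) \<in> topspace ?X" for s
      by simp
    then show ?thesis
      by (cases x; cases "fst x"; cases "snd x") (simp_all add: c)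
  qed

  obtain c where c: "\<forall>l \<in> labels P. edge_arrows G (lab l) (\<lambda>x. c (l, x))"
    and gaps: "gaps P = {{p \<in> endpoints P. c p \<in> ?X closure_of K} | K. K \<in> free_arcs G} - {{}}"
    using P unfolding presents_def by - (elim exE conjE, rule that)
  have lab: "bij_betw lab (labels P) (edges G)"
    using P by (simp add: presents_def)
  have inj_img: "inj_on (image f) (Pow (topspace ?X))"
    by (rule inj_on_image_Pow[OF inj])
  have "edges G \<subseteq> Pow (topspace ?X)" and verts_Pow: "verts G \<subseteq> Pow (topspace ?X)"
    using V E by blast+
  then have "bij_betw (image f) (edges G) (edges H)"
    using inj_on_subset[OF inj_img] edges by (simp add: bij_betw_def)
  with lab have "bij_betw (image f \<circ> lab) (labels P) (edges H)"
    by (rule bij_betw_trans)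
  moreover have "edge_arrows H (f ` lab l) (\<lambda>x. (f \<circ> c) (l, x))" if "l \<in> labels P" for l
    using arrows[of "lab l" "\<lambda>x. c (l, x)"] c that bij_betwE[OF lab] by (simp add: comp_def)
  moreover have "gaps P = {{p \<in> endpoints P. (f \<circ> c) p \<in> ?Y closure_of K} | K. K \<in> free_arcs H} - {{}}"
  proof -
    have "{p \<in> endpoints P. (f \<circ> c) p \<in> ?Y closure_of (f ` K)} = {p \<in> endpoints P. c p \<in> ?X closure_of K}"
      if K: "K \<in> free_arcs G" for K
    proof -
      have "c p \<in> topspace ?X" if "p \<in> endpoints P" for p
        using arrow_point[of "lab (fst p)" "\<lambda>x. c (fst p, x)" "snd p"] c that
        by (simp add: endpoints_def mem_Times_iff)
      then have "f (c p) \<in> f ` (?X closure_of K) \<longleftrightarrow> c p \<in> ?X closure_of K" if "p \<in> endpoints P" for p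
        using that closure_of_subset_topspace by (intro inj_on_image_mem_iff[OF inj])
      moreover have "?Y closure_of (f ` K) = f ` (?X closure_of K)"
        by (rule homeomorphic_map_closure_of[OF f arc_sub[OF K]])
      ultimately show ?thesis
        by (intro Collect_cong conj_cong) simp_all
    qed
    then show ?thesis
      unfolding gaps arcs Setcompr_eq_image image_image[of _ "image f"] by (simp cong: image_cong_simp)
  qed
  moreover have "card {v \<in> verts H. v \<inter> \<Union>(edges H) = {}} = card {v \<in> verts G. v \<inter> \<Union>(edges G) = {}}"
  proof -
    have "f ` v \<inter> \<Union>(edges H) = {} \<longleftrightarrow> v \<inter> \<Union>(edges G) = {}" if "v \<in> verts G" for v
    proof -
      have "f ` v \<inter> \<Union>(edges H) = f ` (v \<inter> \<Union>(edges G))"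
        unfolding edges image_Union[symmetric] using that verts_Pow E
        by (intro inj_on_image_Int[OF inj, symmetric]) auto
      then show ?thesis by simp
    qed
    then have "{v \<in> verts H. v \<inter> \<Union>(edges H) = {}} = image f ` {v \<in> verts G. v \<inter> \<Union>(edges G) = {}}"
      unfolding verts by auto
    moreover have "inj_on (image f) {v \<in> verts G. v \<inter> \<Union>(edges G) = {}}"
      using verts_Pow by (intro inj_on_subset[OF inj_img]) blast
    ultimately show ?thesis
      by (simp add: card_image)
  qed
  ultimately show ?thesis
    using P unfolding presents_def by (intro conjI exI[of _ "f \<circ> c"]) (simp_all add: comp_def)
qed

section \<open>The action on ordered ribbon graphs\<close>

text \<open>
  Twisted duality of ordered graphs with both the group elements and the edge correspondence indexed by
  positions in the order. In this form the semidirect product becomes composition together with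
  reindexing.
\<close>

definition twists ::
    "nat \<Rightarrow> (nat \<Rightarrow> frakS) \<Rightarrow> 'a ribbon \<Rightarrow> (nat \<Rightarrow> 'a set) \<Rightarrow> 'a ribbon \<Rightarrow> (nat \<Rightarrow> 'a set) \<Rightarrow> bool" where
  "twists n \<gamma> G ell G' ell' \<longleftrightarrow>
     (\<exists>\<Gamma> \<rho>. twisted_dual G \<Gamma> G' \<rho> \<and> (\<forall>i \<in> {1..n}. \<Gamma> (ell i) = \<gamma> i \<and> \<rho> (ell i) = ell' i))"

lemma twists_cong:
  assumes "twists n \<gamma> G ell G' ell'" "\<And>i. i \<in> {1..n} \<Longrightarrow> \<gamma> i = \<gamma>' i"
  shows "twists n \<gamma>' G ell G' ell'"
  using assms unfolding twists_def by simp

lemma twists_compose: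
  assumes "twists n \<gamma> G0 ell0 G1 ell1" "twists n \<gamma>' G1 ell1 G2 ell2"
  shows "twists n (\<lambda>i. frakS_mult (\<gamma>' i) (\<gamma> i)) G0 ell0 G2 ell2"
proof -
  obtain \<Gamma> \<rho> where 1: "twisted_dual G0 \<Gamma> G1 \<rho>"
      "\<forall>i \<in> {1..n}. \<Gamma> (ell0 i) = \<gamma> i \<and> \<rho> (ell0 i) = ell1 i"
    using assms(1) unfolding twists_def by - (elim exE conjE, rule that)
  obtain \<Delta> \<rho>' where 2: "twisted_dual G1 \<Delta> G2 \<rho>'"
      "\<forall>i \<in> {1..n}. \<Delta> (ell1 i) = \<gamma>' i \<and> \<rho>' (ell1 i) = ell2 i"
    using assms(2) unfolding twists_def by - (elim exE conjE, rule that)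
  show ?thesis
    unfolding twists_def using twisted_dual_compose[OF 1(1) 2(1)] 1(2) 2(2)
    by (intro exI[of _ "\<lambda>e. frakS_mult (\<Delta> (\<rho> e)) (\<Gamma> e)"] exI[of _ "\<rho>' \<circ> \<rho>"]) simp
qed

lemma twists_inverse:
  assumes "twists n \<gamma> G ell G' ell'"
    and ell: "bij_betw ell {1..n} (edges G)" and ell': "inj_on ell' {1..n}"
  shows "twists n (\<lambda>i. inv\<^bsub>frakS_group\<^esub> (\<gamma> i)) G' ell' G ell"
proof -
  obtain \<Gamma> \<rho> where \<Gamma>: "twisted_dual G \<Gamma> G' \<rho>"
      "\<forall>i \<in> {1..n}. \<Gamma> (ell i) = \<gamma> i \<and> \<rho> (ell i) = ell' i"
    using assms(1) unfolding twists_def by - (elim exE conjE, rule that)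
  define idx where "idx = the_inv_into {1..n} ell'"
  have idx: "idx (ell' i) = i" if "i \<in> {1..n}" for i
    using that ell' by (simp add: idx_def the_inv_into_f_f)
  have "twisted_dual G' (\<lambda>e. inv\<^bsub>frakS_group\<^esub> (\<gamma> (idx e))) G (\<lambda>e. ell (idx e))"
    using \<Gamma>(1)
  proof (rule twisted_dual_inverse)
    fix e assume "e \<in> edges G"
    then obtain i where i: "i \<in> {1..n}" "e = ell i"
      unfolding bij_betw_imp_surj_on[OF ell, symmetric] by blast
    then show "ell (idx (\<rho> e)) = e"
      "frakS_mult (inv\<^bsub>frakS_group\<^esub> \<gamma> (idx (\<rho> e))) (\<Gamma> e) = frakS_one"
      using \<Gamma>(2) by (simp_all add: idx frakS_group_simps)
  qed
  then show ?thesis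
    unfolding twists_def
    by (intro exI[of _ "\<lambda>e. inv\<^bsub>frakS_group\<^esub> (\<gamma> (idx e))"] exI[of _ "\<lambda>e. ell (idx e)"]) (simp add: idx)
qed

lemma twists_reindex:
  assumes "twists n \<gamma> G ell G' ell'" "\<pi> permutes {1..n}"
  shows "twists n (\<gamma> \<circ> \<pi>) G (ell \<circ> \<pi>) G' (ell' \<circ> \<pi>)"
proof -
  obtain \<Gamma> \<rho> where \<Gamma>: "twisted_dual G \<Gamma> G' \<rho>"
      "\<forall>i \<in> {1..n}. \<Gamma> (ell i) = \<gamma> i \<and> \<rho> (ell i) = ell' i"
    using assms(1) unfolding twists_def by - (elim exE conjE, rule that)
  have "\<forall>i \<in> {1..n}. \<Gamma> ((ell \<circ> \<pi>) i) = (\<gamma> \<circ> \<pi>) i \<and> \<rho> ((ell \<circ> \<pi>) i) = (ell' \<circ> \<pi>) i"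
    using \<Gamma>(2) permutes_in_image[OF assms(2)] by (simp del: atLeastAtMost_iff)
  with \<Gamma>(1) show ?thesis
    unfolding twists_def by (intro exI[of _ \<Gamma>] exI[of _ \<rho>] conjI)
qed

text \<open>
  An isomorphism realises the identity operation, but only once some arrow presentation of \<open>G\<close> is
  known. In the applications one is supplied by another twisted dual of \<open>G\<close>
  (\<open>twists_presents\<close>).
\<close>

lemma twists_trivial:
  assumes G: "ribbon_graph G" and P: "presents P G (\<lambda>e. e)"
    and f: "ribbon_iso G G' f" "\<And>i. i \<in> {1..n} \<Longrightarrow> f ` ell i = ell' i"
  shows "twists n (\<lambda>_. frakS_one) G ell G' ell'"
proof -
  have "presents (apply_words (\<lambda>_. []) P) G' (\<lambda>e. f ` e)"
    using presents_image[OF G f(1) P] by (simp add: apply_words_trivial)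
  then have "twisted_dual G (\<lambda>_. frakS_one) G' (\<lambda>e. f ` e)"
    unfolding twisted_dual_def using P
    by (intro exI[of _ P] exI[of _ "\<lambda>_. []"]) (simp add: of_word_Nil)
  then show ?thesis
    unfolding twists_def using f(2)
    by (intro exI[of _ "\<lambda>_. frakS_one"] exI[of _ "\<lambda>e. f ` e"]) simp
qed

lemma twists_presents:
  assumes "twists n \<gamma> G ell G' ell'"
  obtains P where "presents P G (\<lambda>e. e)"
  using assms unfolding twists_def twisted_dual_def by - (elim exE conjE, rule that)

lemma bij_betw_comp_permutes:
  "bij_betw f A B \<Longrightarrow> \<pi> permutes A \<Longrightarrow> bij_betw (f \<circ> \<pi>) A B"
  using bij_betw_trans permutes_imp_bij by blast

lemma act_iff_twists:
  assumes C: "C \<subseteq> ordered_ribbon_graphs n" and \<pi>: "\<pi> permutes {1..n}"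
  shows "(G', ell') \<in> act n (\<gamma>, \<pi>) C \<longleftrightarrow>
    (G', ell') \<in> ordered_ribbon_graphs n \<and> (\<exists>(G, ell) \<in> C. twists n \<gamma> G (ell \<circ> inv' \<pi>) G' ell')"
proof -
  have iff: "(\<exists>\<rho>. twisted_dual G (Gamma n \<gamma> (ell \<circ> inv' \<pi>)) G' \<rho> \<and>
        (\<forall>i \<in> {1..n}. ell' i = \<rho> ((ell \<circ> inv' \<pi>) i))) \<longleftrightarrow> twists n \<gamma> G (ell \<circ> inv' \<pi>) G' ell'"
    (is "?L \<longleftrightarrow> ?R") if "(G, ell) \<in> C" for G ell
  proof -
    define m where "m = ell \<circ> inv' \<pi>"
    have "bij_betw ell {1..n} (edges G)"
      using that C by (auto simp: ordered_ribbon_graphs_def)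
    then have m: "bij_betw m {1..n} (edges G)"
      unfolding m_def by (rule bij_betw_comp_permutes) (rule permutes_inv[OF \<pi>])
    then have Gamma: "Gamma n \<gamma> m (m i) = \<gamma> i" if "i \<in> {1..n}" for i
      using that by (simp add: Gamma_def the_inv_into_f_f bij_betw_def)
    show ?thesis
      unfolding m_def[symmetric]
    proof
      assume "\<exists>\<rho>. twisted_dual G (Gamma n \<gamma> m) G' \<rho> \<and> (\<forall>i \<in> {1..n}. ell' i = \<rho> (m i))"
      then obtain \<rho> where "twisted_dual G (Gamma n \<gamma> m) G' \<rho>" "\<forall>i \<in> {1..n}. ell' i = \<rho> (m i)"
        by - (elim exE conjE, rule that)
      then show "twists n \<gamma> G m G' ell'"
        unfolding twists_def using Gamma by (intro exI[of _ "Gamma n \<gamma> m"] exI[of _ \<rho>]) simp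
    next
      assume "twists n \<gamma> G m G' ell'"
      then obtain \<Gamma> \<rho> where \<Gamma>: "twisted_dual G \<Gamma> G' \<rho>"
          "\<forall>i \<in> {1..n}. \<Gamma> (m i) = \<gamma> i \<and> \<rho> (m i) = ell' i"
        unfolding twists_def by - (elim exE conjE, rule that)
      have "\<Gamma> e = Gamma n \<gamma> m e" if e: "e \<in> edges G" for e
      proof -
        obtain i where "i \<in> {1..n}" "e = m i"
          using e unfolding bij_betw_imp_surj_on[OF m, symmetric] by blast
        then show ?thesis using \<Gamma>(2) Gamma by simp
      qed
      then have "twisted_dual G (Gamma n \<gamma> m) G' \<rho>"
        by (rule twisted_dual_cong[OF \<Gamma>(1)]) simp_all
      with \<Gamma>(2) show "\<exists>\<rho>. twisted_dual G (Gamma n \<gamma> m) G' \<rho> \<and> (\<forall>i \<in> {1..n}. ell' i = \<rho> (m i))"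
        by (intro exI[of _ \<rho>]) simp
    qed
  qed
  have "(G', ell') \<in> act n (\<gamma>, \<pi>) C \<longleftrightarrow> (G', ell') \<in> ordered_ribbon_graphs n \<and>
      (\<exists>x \<in> C. \<exists>\<rho>. twisted_dual (fst x) (Gamma n \<gamma> (snd x \<circ> inv' \<pi>)) G' \<rho> \<and>
        (\<forall>i \<in> {1..n}. ell' i = \<rho> ((snd x \<circ> inv' \<pi>) i)))"
    unfolding act_def by (simp add: case_prod_beta)
  also have "\<dots> \<longleftrightarrow> (G', ell') \<in> ordered_ribbon_graphs n \<and>
      (\<exists>x \<in> C. twists n \<gamma> (fst x) (snd x \<circ> inv' \<pi>) G' ell')"
    using iff[of "fst x" "snd x" for x] by (intro conj_cong HOL.refl bex_cong) simp_all
  finally show ?thesis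
    by (simp add: case_prod_beta)
qed

lemma G_or_subset: "C \<in> G_or n \<Longrightarrow> C \<subseteq> ordered_ribbon_graphs n"
  unfolding G_or_def quotient_def ordered_iso_def by auto

lemma G_or_iso:
  assumes "C \<in> G_or n" "(G, ell) \<in> C" "(G', ell') \<in> C"
  obtains f where "ribbon_iso G G' f" "\<And>i. i \<in> {1..n} \<Longrightarrow> f ` ell i = ell' i"
proof -
  obtain K m where K: "(K, m) \<in> ordered_ribbon_graphs n" "C = ordered_iso n `` {(K, m)}"
    using assms(1) unfolding G_or_def by (auto elim!: quotientE)
  obtain g where g: "ribbon_iso K G g" "\<forall>i \<in> {1..n}. g ` m i = ell i"
    using assms(2) unfolding K(2) ordered_iso_def by auto
  obtain f where f: "ribbon_iso K G' f" "\<forall>i \<in> {1..n}. f ` m i = ell' i"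
    using assms(3) unfolding K(2) ordered_iso_def by auto
  have "ribbon_graph K" and m: "bij_betw m {1..n} (edges K)"
    using K(1) by (auto simp: ordered_ribbon_graphs_def)
  obtain h where h: "ribbon_iso G K h" "\<And>x. x \<in> topspace (surf K) \<Longrightarrow> h (g x) = x"
    using ribbon_iso_inverse[OF g(1) \<open>ribbon_graph K\<close>] by metis
  have "(f \<circ> h) ` ell i = ell' i" if i: "i \<in> {1..n}" for i
  proof -
    have "m i \<in> edges K"
      using m i by (auto simp: bij_betw_def)
    then have "m i \<subseteq> topspace (surf K)"
      using disc_subset_topspace[OF \<open>ribbon_graph K\<close>] by simp
    then have "(\<lambda>x. h (g x)) ` m i = (\<lambda>x. x) ` m i"
      using h(2) by (intro image_cong) auto
    then have "h ` ell i = m i"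
      using g(2) i by (metis image_ident image_image)
    then show ?thesis
      using f(2) i unfolding image_comp[symmetric] by simp
  qed
  with ribbon_iso_compose[OF h(1) f(1)] show thesis by (rule that)
qed

text \<open>
  The hypothesis on \<open>(1, \<mu>)\<close> speaks of the whole class; here it is turned into a statement about the
  single graph \<open>K\<close>, because \<open>(K, \<ell>\<mu>\<^sup>-\<^sup>1)\<close> is one of the graphs that \<open>(1, \<mu>)\<close> produces from \<open>(K, \<ell>)\<close>.
\<close>

lemma automorphism_acts:
  assumes H: "H \<in> G_or n" and \<mu>: "\<mu> permutes {1..n}"
    and fix_H: "act n (\<one>\<^bsub>frakS_pow n\<^esub>, \<mu>) H = H"
    and K: "(K, ell) \<in> H" and P: "presents P K (\<lambda>e. e)"
  shows "(K, ell \<circ> inv' \<mu>) \<in> H"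
proof -
  note sub = G_or_subset[OF H]
  have KO: "ribbon_graph K" "bij_betw ell {1..n} (edges K)"
    using K sub by (auto simp: ordered_ribbon_graphs_def)
  have id: "ribbon_iso K K id"
    by (simp add: ribbon_iso_def)
  have "twists n (\<lambda>_. frakS_one) K (ell \<circ> inv' \<mu>) K (ell \<circ> inv' \<mu>)"
    by (rule twists_trivial[OF KO(1) P id]) simp
  then have "twists n \<one>\<^bsub>frakS_pow n\<^esub> K (ell \<circ> inv' \<mu>) K (ell \<circ> inv' \<mu>)"
    by (rule twists_cong) (simp add: frakS_group_def)
  moreover have "(K, ell \<circ> inv' \<mu>) \<in> ordered_ribbon_graphs n"
    using KO bij_betw_comp_permutes[OF KO(2) permutes_inv[OF \<mu>]]
    by (simp add: ordered_ribbon_graphs_def)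
  ultimately have "(K, ell \<circ> inv' \<mu>) \<in> act n (\<one>\<^bsub>frakS_pow n\<^esub>, \<mu>) H"
    unfolding act_iff_twists[OF sub \<mu>] using K by blast
  then show ?thesis
    unfolding fix_H .
qed

theorem theorem5p6:
  fixes n :: nat and H G :: "'a ordered_ribbon set"
    and \<mu> :: "nat \<Rightarrow> nat" and \<alpha> \<gamma>' :: "nat \<Rightarrow> frakS"
  assumes "n \<ge> 1"
    and "H \<in> G_or n"
    and "\<mu> \<in> carrier (sym_group n)"
    and "act n (\<one>\<^bsub>frakS_pow n\<^esub>, \<mu>) H = H"
    and "\<alpha> \<in> carrier (frakS_pow n)"
    and "G = act n (\<alpha>, \<one>\<^bsub>sym_group n\<^esub>) H"
    and "\<gamma>' = \<alpha> \<otimes>\<^bsub>frakS_pow n\<^esub> ((inv\<^bsub>frakS_pow n\<^esub> \<alpha>) \<circ> inv' \<mu>)"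
  shows "self_via n \<gamma>' \<mu> G \<and> (\<gamma>' \<noteq> \<one>\<^bsub>frakS_pow n\<^esub> \<longleftrightarrow> \<alpha> \<noteq> \<alpha> \<circ> inv' \<mu>)"
proof -
  define \<nu> where "\<nu> = inv' \<mu>"
  have \<mu>: "\<mu> permutes {1..n}"
    using assms(3) by (simp add: sym_group_def)
  then have \<nu>: "\<nu> permutes {1..n}"
    unfolding \<nu>_def by (rule permutes_inv)
  then have \<nu>_in: "\<nu> i \<in> {1..n} \<longleftrightarrow> i \<in> {1..n}" for i
    by (rule permutes_in_image)
  have \<gamma>': "\<gamma>' = (\<lambda>i \<in> {1..n}. frakS_mult (\<alpha> i) (inv\<^bsub>frakS_group\<^esub> (\<alpha> (\<nu> i))))"
  proof -
    have "inv\<^bsub>frakS_pow n\<^esub> \<alpha> = (\<lambda>i \<in> {1..n}. inv\<^bsub>frakS_group\<^esub> (\<alpha> i))"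
      using assms(5) by (intro inv_product_group) (simp_all add: group_frakS_group)
    then show ?thesis
      unfolding assms(7) \<nu>_def[symmetric] using \<nu>_in
      by (simp add: fun_eq_iff restrict_def frakS_group_def del: atLeastAtMost_iff)
  qed
  note sub = G_or_subset[OF assms(2)]
  have G_iff: "(G', ell') \<in> G \<longleftrightarrow> (G', ell') \<in> ordered_ribbon_graphs n \<and>
      (\<exists>(K, ell) \<in> H. twists n \<alpha> K ell G' ell')" for G' ell'
    unfolding assms(6) sym_group_def using act_iff_twists[OF sub permutes_id, of G' ell' \<alpha>] by simp
  have G_sub: "G \<subseteq> ordered_ribbon_graphs n"
    using G_iff by auto
  note act_G = act_iff_twists[OF G_sub \<mu>, folded \<nu>_def]
  note in_H = automorphism_acts[OF assms(2) \<mu> assms(4), folded \<nu>_def]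

  \<comment> \<open>As positions are reindexed by \<open>\<nu> = \<mu>\<^sup>-\<^sup>1\<close>, the path from \<open>K\<close> through \<open>G1\<close> to \<open>G2\<close> applies \<open>\<gamma>' \<cdot> \<alpha>\<mu>\<^sup>-\<^sup>1 = \<alpha>\<close>.\<close>
  have "act n (\<gamma>', \<mu>) G \<subseteq> G"
  proof (rule subrelI)
    fix G2 ell2 assume "(G2, ell2) \<in> act n (\<gamma>', \<mu>) G"
    then obtain G1 ell1 where 2: "(G2, ell2) \<in> ordered_ribbon_graphs n"
        and 1: "(G1, ell1) \<in> G" "twists n \<gamma>' G1 (ell1 \<circ> \<nu>) G2 ell2"
      unfolding act_G by blast
    obtain K ell where K: "(K, ell) \<in> H" "twists n \<alpha> K ell G1 ell1"
      using 1(1) unfolding G_iff by blast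
    have "twists n (\<lambda>i. frakS_mult (\<gamma>' i) ((\<alpha> \<circ> \<nu>) i)) K (ell \<circ> \<nu>) G2 ell2"
      by (rule twists_compose[OF twists_reindex[OF K(2) \<nu>] 1(2)])
    then have "twists n \<alpha> K (ell \<circ> \<nu>) G2 ell2"
      by (rule twists_cong) (simp add: \<gamma>' frakS_group_simps)
    moreover obtain P where "presents P K (\<lambda>e. e)"
      using K(2) by (rule twists_presents)
    then have "(K, ell \<circ> \<nu>) \<in> H"
      by (rule in_H[OF K(1)])
    ultimately show "(G2, ell2) \<in> G"
      unfolding G_iff using 2 by blast
  qed
  \<comment> \<open>Round trip from \<open>G'\<close> to \<open>K\<close>, by the automorphism \<open>f\<close> of \<open>K\<close>, and back to \<open>G'\<close>.\<close>
  moreover have "G \<subseteq> act n (\<gamma>', \<mu>) G"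
  proof (rule subrelI)
    fix G' ell' assume G': "(G', ell') \<in> G"
    then obtain K ell where K: "(K, ell) \<in> H" "twists n \<alpha> K ell G' ell'"
      and O': "(G', ell') \<in> ordered_ribbon_graphs n"
      unfolding G_iff by blast
    have ord: "ribbon_graph K" "bij_betw ell {1..n} (edges K)" "inj_on ell' {1..n}"
      using subsetD[OF sub K(1)] O' by (auto simp: ordered_ribbon_graphs_def bij_betw_def)
    obtain P where P: "presents P K (\<lambda>e. e)"
      using K(2) by (rule twists_presents)
    obtain f where f: "ribbon_iso K K f" "\<And>i. i \<in> {1..n} \<Longrightarrow> f ` (ell \<circ> \<nu>) i = ell i"
      using G_or_iso[OF assms(2) in_H[OF K(1) P] K(1)] by metis
    have inv: "twists n ((\<lambda>i. inv\<^bsub>frakS_group\<^esub> (\<alpha> i)) \<circ> \<nu>) G' (ell' \<circ> \<nu>) K (ell \<circ> \<nu>)"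
      by (rule twists_reindex[OF twists_inverse[OF K(2) ord(2,3)] \<nu>])
    have triv: "twists n (\<lambda>_. frakS_one) K (ell \<circ> \<nu>) K ell"
      by (rule twists_trivial[OF ord(1) P f])
    have "twists n (\<lambda>i. frakS_mult (\<alpha> i) (frakS_mult frakS_one
        (((\<lambda>i. inv\<^bsub>frakS_group\<^esub> (\<alpha> i)) \<circ> \<nu>) i))) G' (ell' \<circ> \<nu>) G' ell'"
      by (rule twists_compose[OF twists_compose[OF inv triv] K(2)])
    then have "twists n \<gamma>' G' (ell' \<circ> \<nu>) G' ell'"
      by (rule twists_cong) (simp add: \<gamma>' frakS_group_simps)
    then show "(G', ell') \<in> act n (\<gamma>', \<mu>) G"
      unfolding act_G using O' G' by blast
  qed
  ultimately have "self_via n \<gamma>' \<mu> G"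
    unfolding self_via_def by (rule equalityI)
  moreover have "\<gamma>' = \<one>\<^bsub>frakS_pow n\<^esub> \<longleftrightarrow> \<alpha> = \<alpha> \<circ> inv' \<mu>"
  proof -
    have cancel: "frakS_mult x (inv\<^bsub>frakS_group\<^esub> y) = frakS_one \<longleftrightarrow> x = y" for x y
    proof
      assume "frakS_mult x (inv\<^bsub>frakS_group\<^esub> y) = frakS_one"
      then have "frakS_mult (frakS_mult x (inv\<^bsub>frakS_group\<^esub> y)) y = y"
        by (simp only: frakS_group_simps(1))
      then show "x = y"
        by (simp only: frakS_group_simps)
    qed (simp add: frakS_group_simps)
    have "\<one>\<^bsub>frakS_pow n\<^esub> = (\<lambda>i \<in> {1..n}. frakS_one)"
      by (simp add: frakS_group_def)
    then have "\<gamma>' = \<one>\<^bsub>frakS_pow n\<^esub> \<longleftrightarrow> (\<forall>i \<in> {1..n}. \<alpha> i = \<alpha> (\<nu> i))"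
      by (auto simp: \<gamma>' cancel fun_eq_iff restrict_def)
    also have "\<dots> \<longleftrightarrow> (\<forall>i. \<alpha> i = \<alpha> (\<nu> i))"
      using permutes_not_in[OF \<nu>] by metis
    finally show ?thesis
      by (simp add: fun_eq_iff \<nu>_def)
  qed
  ultimately show ?thesis by blast
qed

end
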